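(* Let $\Omega\subset X$ be a nonempty open set with $X\setminus\Omega\neq\emptyset$ satisfying the measure doubling condition: there is $c_d>0$ such that $0<\mu(B(x,2r)\cap\Omega)\le c_d\,\mu(B(x,r)\cap\Omega)<\infty$ for every $x\in\overline\Omega$ and every $r>0$. Let $\widetilde{\mathcal H}$ be any Radon measure on $\partial\Omega$. Suppose that for a given $u\in N^{1,1}(\Omega)$ there exists a function $Tu$ such that \[ \lim_{r\to0^+}\frac{1}{\mu(B(x,r)\cap\Omega)}\int_{B(x,r)\cap\Omega}|u-Tu(x)|\,d\mu=0 \] for $\widetilde{\mathcal H}$-a.e. $x\in\partial\Omega$. Then there exist $0<c_H<1$ and $v\in M^{1,1}_{c_H}(\Omega)\cap\mathrm{Lip}_{\mathrm{loc}}(\Omega)$ such that $\|v\|_{M^{1,1}_{c_H}(\Omega)}\le C\|u\|_{N^{1,1}(\Omega)}$, with a constant $C$ independent of $u$, and \[ \lim_{r\to0^+}\frac{1}{\mu(B(x,r)\cap\Omega)}\int_{B(x,r)\cap\Omega}|v-Tu(x)|\,d\mu=0 \] for $\widetilde{\mathcal H}$-a.e. $x\in\partial\Omega$. If additionally $\Omega$ is a uniform domain, then $v$ can be chosen in $M^{1,1}(\Omega)\cap\mathrm{Lip}_{\mathrm{loc}}(\Omega)$.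
   Context: Standing assumptions: $(X,d,\mu)$ is a complete metric space with a Borel regular outer measure $\mu$ that is doubling: there is $C_d\ge 1$ with $0<\mu(B(x,2r))\le C_d\,\mu(B(x,r))<\infty$ for all balls $B(x,r)=\{y\in X: d(x,y)<r\}$. $X$ supports a $(1,1)$-Poincaré inequality: there are $C_P>0$, $\lambda\ge 1$ such that for every ball $B(x,r)$, every $u\in L^1_{\mathrm{loc}}(X)$ and every upper gradient $g$ of $u$, $\frac{1}{\mu(B(x,r))}\int_{B(x,r)}|u-u_{B(x,r)}|\,d\mu\le C_P r\,\frac{1}{\mu(B(x,\lambda r))}\int_{B(x,\lambda r)}g\,d\mu$, where $u_B$ is the $\mu$-mean of $u$ over $B$. A curve is a rectifiable continuous map from a compact interval. A nonnegative Borel function $g$ is an upper gradient of $u$ if $|u(x)-u(y)|\le\int_\gamma g\,ds$ for all nonconstant curves $\gamma$ with end points $x,y$ (with $|u(x)-u(y)|:=\infty$ if $|u(x)|$ or $|u(y)|$ is infinite). A curve family $\Gamma$ has zero $1$-modulus if there is a nonnegative Borel $\rho\in L^1(X)$ with $\int_\gamma\rho\,ds=\infty$ for all $\gamma\in\Gamma$. A nonnegative $\mu$-measurable $g$ is a $1$-weak upper gradient of $u$ in $H\subset X$ if the upper gradient inequality holds for all curves in $H$ outside a family of zero $1$-modulus. $\|u\|_{N^{1,1}(H)}:=\|u\|_{L^1(H)}+\inf\|g\|_{L^1(H)}$ (infimum over $1$-weak upper gradients of $u$ in $H$), $N^{1,1}(H)=\{u:\|u\|_{N^{1,1}(H)}<\infty\}$.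 $\mathrm{Lip}_{\mathrm{loc}}(\Omega)$ is the set of functions that are Lipschitz on every open $\Omega'$ whose closure is a compact subset of $\Omega$. Hajłasz-Sobolev spaces: $M^{1,1}(\Omega)$ is the set of $u\in L^1(\Omega)$ for which there exist $0\le g\in L^1(\Omega)$ and a set $A\subset\Omega$ of $\mu$-measure zero such that $|u(x)-u(y)|\le d(x,y)(g(x)+g(y))$ for all $x,y\in\Omega\setminus A$; the norm is $\|u\|_{L^1(\Omega)}+\inf\|g\|_{L^1(\Omega)}$ over all such $g$. For $0<c_H<1$, $M^{1,1}_{c_H}(\Omega)$ and its norm are defined in the same way, except that the inequality is only required for those $x,y\in\Omega\setminus A$ with $d(x,y)\le c_H\min\{\mathrm{dist}(x,X\setminus\Omega),\mathrm{dist}(y,X\setminus\Omega)\}$. A domain $\Omega\subset X$ is uniform if there is $c_U\in(0,1]$ such that every pair of distinct points $x,y\in\Omega$ can be joined by a curve $\gamma:[0,\ell_\gamma]\to\Omega$ parametrized by arc-length with $\gamma(0)=x$, $\gamma(\ell_\gamma)=y$, $\ell_\gamma\le c_U^{-1}d(x,y)$ and $\mathrm{dist}(\gamma(t),X\setminus\Omega)\ge c_U\min\{t,\ell_\gamma-t\}$ for all $t\in[0,\ell_\gamma]$. *)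

theory Defs
  imports "HOL-Analysis.Analysis"
begin

definition borel_regular_outer_measure :: "('a::metric_space set \<Rightarrow> ennreal) \<Rightarrow> bool" where
  "borel_regular_outer_measure mu \<longleftrightarrow>
     outer_measure_space (Pow UNIV) mu \<and>
     sets borel \<subseteq> lambda_system UNIV (Pow UNIV) mu \<and>
     (\<forall>A. \<exists>B\<in>sets borel. A \<subseteq> B \<and> mu B = mu A)"

(* Radon measures are outer measures on the subsets of S, as in Federer and Mattila. *)
definition radon_measure_on :: "'a::metric_space set \<Rightarrow> ('a set \<Rightarrow> ennreal) \<Rightarrow> bool" where
  "radon_measure_on S nu \<longleftrightarrow>
     outer_measure_space (Pow S) nu \<and>
     sets (restrict_space borel S) \<subseteq> lambda_system S (Pow S) nu \<and>
     (\<forall>K. compact K \<and> K \<subseteq> S \<longrightarrow> nu K < \<infinity>) \<and>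
     (\<forall>U. openin (top_of_set S) U \<longrightarrow> nu U = (SUP K\<in>{K. compact K \<and> K \<subseteq> U}. nu K)) \<and>
     (\<forall>A\<subseteq>S. nu A = (INF U\<in>{U. openin (top_of_set S) U \<and> A \<subseteq> U}. nu U))"

(* The complete measure on S whose measurable sets are the Caratheodory measurable ones;
   "mu-measurable" and "mu-a.e." refer to it. *)
definition induced_measure :: "'a set \<Rightarrow> ('a set \<Rightarrow> ennreal) \<Rightarrow> 'a measure" where
  "induced_measure S mu = measure_of S (lambda_system S (Pow S) mu) mu"

lemma
  assumes "outer_measure_space (Pow S) mu"
  shows space_induced_measure: "space (induced_measure S mu) = S"
    and sets_induced_measure: "sets (induced_measure S mu) = lambda_system S (Pow S) mu"
    and emeasure_induced_measure:
      "A \<in> lambda_system S (Pow S) mu \<Longrightarrow> emeasure (induced_measure S mu) A = mu A"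
proof -
  have ms: "measure_space S (lambda_system S (Pow S) mu) mu"
    using sigma_algebra.caratheodory_lemma[OF sigma_algebra_Pow assms] .
  then interpret sigma_algebra S "lambda_system S (Pow S) mu"
    by (simp add: measure_space_def)
  show "space (induced_measure S mu) = S"
    by (simp add: induced_measure_def space_closed space_measure_of)
  show sets: "sets (induced_measure S mu) = lambda_system S (Pow S) mu"
    by (simp add: induced_measure_def sets_measure_of_eq)
  show "emeasure (induced_measure S mu) A = mu A" if "A \<in> lambda_system S (Pow S) mu"
    using ms that
    by (intro emeasure_measure_of[OF induced_measure_def space_closed])
       (auto simp: sets measure_space_def)
qed

definition doubling_on :: "'a::metric_space measure \<Rightarrow> 'a set \<Rightarrow> real \<Rightarrow> bool" where
  "doubling_on M H c \<longleftrightarrow> (\<forall>x\<in>closure H. \<forall>r>0.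
     0 < emeasure M (ball x (2 * r) \<inter> H) \<and>
     emeasure M (ball x (2 * r) \<inter> H) \<le> ennreal c * emeasure M (ball x r \<inter> H) \<and>
     ennreal c * emeasure M (ball x r \<inter> H) < \<infinity>)"


(* The absolute difference of extended reals, infinite as soon as one argument is infinite
   (in Isabelle, \<infinity> - \<infinity> = \<infinity>). *)
definition absdiff :: "ereal \<Rightarrow> ereal \<Rightarrow> ennreal" where
  "absdiff x y = e2ennreal \<bar>x - y\<bar>"

lemma absdiff_infinite: "\<bar>x\<bar> = \<infinity> \<or> \<bar>y\<bar> = \<infinity> \<Longrightarrow> absdiff x y = \<infinity>"
  by (cases x; cases y) (auto simp: absdiff_def)

lemma absdiff_ereal: "absdiff (ereal x) (ereal y) = ennreal \<bar>x - y\<bar>"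
  by (simp add: absdiff_def)

definition L1_norm :: "'a measure \<Rightarrow> 'a set \<Rightarrow> ('a \<Rightarrow> ereal) \<Rightarrow> ennreal" where
  "L1_norm M H u = (\<integral>\<^sup>+x. e2ennreal \<bar>u x\<bar> \<partial>restrict_space M H)"

definition L1_space :: "'a measure \<Rightarrow> 'a set \<Rightarrow> ('a \<Rightarrow> ereal) set" where
  "L1_space M H = {u \<in> borel_measurable (restrict_space M H). L1_norm M H u < \<infinity>}"

definition L1_loc :: "'a::metric_space measure \<Rightarrow> ('a \<Rightarrow> ereal) set" where
  "L1_loc M = {u. \<forall>V. open V \<and> compact (closure V) \<longrightarrow> u \<in> L1_space M V}"

(* Intended for u in L^1(B), where u is finite a.e.; real_of_ereal maps infinite values to 0. *)
definition mean_value :: "'a measure \<Rightarrow> 'a set \<Rightarrow> ('a \<Rightarrow> ereal) \<Rightarrow> real" where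
  "mean_value M B u = (\<integral>x. real_of_ereal (u x) \<partial>restrict_space M B) / measure M B"

definition mean_deviation :: "'a measure \<Rightarrow> 'a set \<Rightarrow> ('a \<Rightarrow> ereal) \<Rightarrow> real \<Rightarrow> ennreal" where
  "mean_deviation M A u c =
     (\<integral>\<^sup>+x. absdiff (u x) (ereal c) \<partial>restrict_space M A) / emeasure M A"


definition curve_length :: "(real \<Rightarrow> 'a::metric_space) \<Rightarrow> real \<Rightarrow> real \<Rightarrow> ennreal" where
  "curve_length \<gamma> a b =
     (SUP (n, t) \<in> {(n::nat, t::nat \<Rightarrow> real). mono_on {..n} t \<and> t ` {..n} \<subseteq> {a..b}}.
        \<Sum>i<n. ennreal (dist (\<gamma> (t i)) (\<gamma> (t (Suc i)))))"

definition curve :: "real \<Rightarrow> real \<Rightarrow> (real \<Rightarrow> 'a::metric_space) \<Rightarrow> bool" where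
  "curve a b \<gamma> \<longleftrightarrow> a \<le> b \<and> continuous_on {a..b} \<gamma> \<and> curve_length \<gamma> a b < \<infinity>"

(* The choice of s is immaterial: a curve is constant on the level sets of
   s \<mapsto> curve_length \<gamma> a s. *)
definition arc_length_reparam ::
    "real \<Rightarrow> real \<Rightarrow> (real \<Rightarrow> 'a::metric_space) \<Rightarrow> real \<Rightarrow> 'a" where
  "arc_length_reparam a b \<gamma> t = \<gamma> (SOME s. s \<in> {a..b} \<and> curve_length \<gamma> a s = ennreal t)"

definition curve_integral ::
    "real \<Rightarrow> real \<Rightarrow> (real \<Rightarrow> 'a::metric_space) \<Rightarrow> ('a \<Rightarrow> ennreal) \<Rightarrow> ennreal" where
  "curve_integral a b \<gamma> g =
     (\<integral>\<^sup>+t\<in>{0..enn2real (curve_length \<gamma> a b)}. g (arc_length_reparam a b \<gamma> t) \<partial>lborel)"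

definition arc_length_parametrized :: "real \<Rightarrow> (real \<Rightarrow> 'a::metric_space) \<Rightarrow> bool" where
  "arc_length_parametrized l \<gamma> \<longleftrightarrow>
     curve 0 l \<gamma> \<and> (\<forall>t\<in>{0..l}. curve_length \<gamma> 0 t = ennreal t)"


definition upper_gradient :: "('a::metric_space \<Rightarrow> ereal) \<Rightarrow> ('a \<Rightarrow> ennreal) \<Rightarrow> bool" where
  "upper_gradient u g \<longleftrightarrow> g \<in> borel_measurable borel \<and>
     (\<forall>a b \<gamma>. curve a b \<gamma> \<and> \<not> \<gamma> constant_on {a..b} \<longrightarrow>
        absdiff (u (\<gamma> a)) (u (\<gamma> b)) \<le> curve_integral a b \<gamma> g)"

definition zero_modulus ::
    "'a::metric_space measure \<Rightarrow> (real \<times> real \<times> (real \<Rightarrow> 'a)) set \<Rightarrow> bool" where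
  "zero_modulus M \<Gamma> \<longleftrightarrow>
     (\<exists>\<rho>::'a \<Rightarrow> ennreal. \<rho> \<in> borel_measurable borel \<and> (\<integral>\<^sup>+x. \<rho> x \<partial>M) < \<infinity> \<and>
        (\<forall>(a, b, \<gamma>)\<in>\<Gamma>. curve_integral a b \<gamma> \<rho> = \<infinity>))"

(* For measurable g the composition of g with the arc-length parametrization is Lebesgue
   measurable outside a family of zero modulus, so the value of curve_integral on the
   remaining curves does not matter. *)
definition weak_upper_gradient ::
    "'a::metric_space measure \<Rightarrow> 'a set \<Rightarrow> ('a \<Rightarrow> ereal) \<Rightarrow> ('a \<Rightarrow> ennreal) \<Rightarrow> bool" where
  "weak_upper_gradient M H u g \<longleftrightarrow> g \<in> borel_measurable (restrict_space M H) \<and>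
     (\<exists>\<Gamma>. zero_modulus M \<Gamma> \<and>
        (\<forall>a b \<gamma>. curve a b \<gamma> \<and> \<not> \<gamma> constant_on {a..b} \<and> \<gamma> ` {a..b} \<subseteq> H \<and> (a, b, \<gamma>) \<notin> \<Gamma> \<longrightarrow>
           absdiff (u (\<gamma> a)) (u (\<gamma> b)) \<le> curve_integral a b \<gamma> g))"

definition poincare_1_1 :: "'a::metric_space measure \<Rightarrow> bool" where
  "poincare_1_1 M \<longleftrightarrow> (\<exists>C>0. \<exists>lam\<ge>1. \<forall>x. \<forall>r>0. \<forall>u\<in>L1_loc M. \<forall>g. upper_gradient u g \<longrightarrow>
     mean_deviation M (ball x r) u (mean_value M (ball x r) u) \<le>
       ennreal (C * r) *
       ((\<integral>\<^sup>+y. g y \<partial>restrict_space M (ball x (lam * r))) / emeasure M (ball x (lam * r))))"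

definition newton_norm :: "'a::metric_space measure \<Rightarrow> 'a set \<Rightarrow> ('a \<Rightarrow> ereal) \<Rightarrow> ennreal" where
  "newton_norm M H u =
     L1_norm M H u +
     (INF g\<in>{g. weak_upper_gradient M H u g}. \<integral>\<^sup>+x. g x \<partial>restrict_space M H)"

definition newton_space :: "'a::metric_space measure \<Rightarrow> 'a set \<Rightarrow> ('a \<Rightarrow> ereal) set" where
  "newton_space M H =
     {u \<in> borel_measurable (restrict_space M H). newton_norm M H u < \<infinity>}"

definition lip_loc :: "'a::metric_space set \<Rightarrow> ('a \<Rightarrow> real) set" where
  "lip_loc \<Omega> = {v. \<forall>V. open V \<and> compact (closure V) \<and> closure V \<subseteq> \<Omega> \<longrightarrow>
     (\<exists>L. L-lipschitz_on V v)}"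


(* P x y says for which pairs of points the pointwise inequality is required. *)
definition hajlasz_gradients ::
    "'a::metric_space measure \<Rightarrow> 'a set \<Rightarrow> ('a \<Rightarrow> 'a \<Rightarrow> bool) \<Rightarrow> ('a \<Rightarrow> ereal) \<Rightarrow> ('a \<Rightarrow> ennreal) set"
  where
  "hajlasz_gradients M \<Omega> P u =
     {g \<in> borel_measurable (restrict_space M \<Omega>).
        (\<integral>\<^sup>+x. g x \<partial>restrict_space M \<Omega>) < \<infinity> \<and>
        (\<exists>A\<in>null_sets M. A \<subseteq> \<Omega> \<and>
           (\<forall>x\<in>\<Omega> - A. \<forall>y\<in>\<Omega> - A. P x y \<longrightarrow>
              absdiff (u x) (u y) \<le> ennreal (dist x y) * (g x + g y)))}"

definition hajlasz_norm_wrt ::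
    "'a::metric_space measure \<Rightarrow> 'a set \<Rightarrow> ('a \<Rightarrow> 'a \<Rightarrow> bool) \<Rightarrow> ('a \<Rightarrow> ereal) \<Rightarrow> ennreal" where
  "hajlasz_norm_wrt M \<Omega> P u =
     L1_norm M \<Omega> u + (INF g\<in>hajlasz_gradients M \<Omega> P u. \<integral>\<^sup>+x. g x \<partial>restrict_space M \<Omega>)"

definition hajlasz_space_wrt ::
    "'a::metric_space measure \<Rightarrow> 'a set \<Rightarrow> ('a \<Rightarrow> 'a \<Rightarrow> bool) \<Rightarrow> ('a \<Rightarrow> ereal) set" where
  "hajlasz_space_wrt M \<Omega> P = {u \<in> L1_space M \<Omega>. hajlasz_gradients M \<Omega> P u \<noteq> {}}"

definition near :: "real \<Rightarrow> 'a::metric_space set \<Rightarrow> 'a \<Rightarrow> 'a \<Rightarrow> bool" where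
  "near c \<Omega> x y \<longleftrightarrow> dist x y \<le> c * min (infdist x (- \<Omega>)) (infdist y (- \<Omega>))"

abbreviation "M11_space M \<Omega> \<equiv> hajlasz_space_wrt M \<Omega> (\<lambda>_ _. True)"
abbreviation "M11_norm M \<Omega> \<equiv> hajlasz_norm_wrt M \<Omega> (\<lambda>_ _. True)"
abbreviation "M11_loc_space M \<Omega> c \<equiv> hajlasz_space_wrt M \<Omega> (near c \<Omega>)"
abbreviation "M11_loc_norm M \<Omega> c \<equiv> hajlasz_norm_wrt M \<Omega> (near c \<Omega>)"


definition uniform_domain :: "'a::metric_space set \<Rightarrow> bool" where
  "uniform_domain \<Omega> \<longleftrightarrow> open \<Omega> \<and> connected \<Omega> \<and> \<Omega> \<noteq> {} \<and>
     (\<exists>c. 0 < c \<and> c \<le> 1 \<and>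
        (\<forall>x\<in>\<Omega>. \<forall>y\<in>\<Omega>. x \<noteq> y \<longrightarrow>
           (\<exists>l \<gamma>. arc_length_parametrized l \<gamma> \<and> \<gamma> ` {0..l} \<subseteq> \<Omega> \<and> \<gamma> 0 = x \<and> \<gamma> l = y \<and>
              l \<le> dist x y / c \<and>
              (\<forall>t\<in>{0..l}. c * min t (l - t) \<le> infdist (\<gamma> t) (- \<Omega>)))))"

definition has_boundary_value ::
    "'a::metric_space measure \<Rightarrow> 'a set \<Rightarrow> ('a \<Rightarrow> ereal) \<Rightarrow> 'a \<Rightarrow> real \<Rightarrow> bool" where
  "has_boundary_value M \<Omega> u x c \<longleftrightarrow>
     ((\<lambda>r. mean_deviation M (ball x r \<inter> \<Omega>) u c) \<longlongrightarrow> 0) (at_right 0)"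

definition is_trace ::
    "'a::metric_space measure \<Rightarrow> ('a set \<Rightarrow> ennreal) \<Rightarrow> 'a set \<Rightarrow> ('a \<Rightarrow> ereal) \<Rightarrow> ('a \<Rightarrow> real) \<Rightarrow> bool"
  where
  "is_trace M nu \<Omega> u Tu \<longleftrightarrow>
     (AE x in induced_measure (frontier \<Omega>) nu. has_boundary_value M \<Omega> u x (Tu x))"

end

(* With d(x) = dist(x, X \ Omega) and psi_x(z) = max(0, eta d(x) - d(x,z)), take
     v(x) = int u psi_x / int psi_x,
   a discrete convolution without Whitney balls or a partition of unity.  Since
     (v(x) - v(y)) int psi_x = int (u - v(y)) (psi_x - psi_y)
   and psi is 2-Lipschitz in x, the Poincare inequality gives |v(x) - v(y)| <= C d(x,y) A(x), where
   A(x) is the mean over B(x, d(x)/2) of an upper gradient g of u.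
   Every such mean A(z) with d(x,z) <= k d(z) is at most a constant times
     S f(x) = int_{d(x,w) < K d(w)} f(w) / mu(B(w,d(w))) dmu(w),   K = 2k + 1,
   for f = g, and by Fubini and doubling S is bounded on L^1(Omega).  So S g is a Hajlasz gradient, S |u|
   controls the L^1 norm, and S (|u - T| 1_{B(x,2r)}) controls the mean deviation of v from T near a
   boundary point x.  In a uniform domain the points of the half of the curve next to x satisfy
   d(x,z) <= k d(z), so v restricted to it is Lipschitz with constant C S g(x), which yields the global
   inequality. *)
theory Submission
  imports Defs
begin

section \<open>Length of curves\<close>

text \<open>The Poincare inequality of the hypothesis concerns functions on all of X and genuine
  Borel upper gradients, whereas \<open>u\<close> is given on \<Omega> and has only weak upper
  gradients there. This mismatch shapes the preparation: a measurable gradient is replaced by a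
  Borel majorant, the exceptional curves are absorbed by a small multiple of a function whose
  integral along them is infinite, and curves leaving \<Omega> get infinite cost, which requires
  some theory of curve length. The scale is \<eta> = 1 / (6 lam): the convolutions at
  \<open>x\<close> and at a point within \<eta> d(x) of \<open>x\<close> only see B(x, 3 \<eta>
  d(x)). Enlarged by \<open>lam\<close>, this is exactly B(x, d(x)/2), whose double is still inside
  \<Omega>. So c_H = \<eta>, and the constants depend only on \<open>c\<close>, \<open>C\<close>,
  \<open>lam\<close> and the uniformity constant. In S the volume is taken at \<open>w\<close> and
  not at \<open>x\<close>: integrating over \<open>x\<close> then leaves a ratio of volumes of
  concentric balls. Fubini needs joint measurability in (x, w), for which separability of \<Omega>
  is derived from doubling.\<close>

lemma curve_length_ge:
  assumes "mono_on {..n} t" "t ` {..n} \<subseteq> {a..b}"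
  shows "(\<Sum>i<n. ennreal (dist (\<gamma> (t i)) (\<gamma> (t (Suc i))))) \<le> curve_length \<gamma> a b"
  unfolding curve_length_def using assms by (intro SUP_upper2[where i="(n,t)"]) auto

lemma curve_length_leI:
  assumes "\<And>n t. mono_on {..n} t \<Longrightarrow> t ` {..n} \<subseteq> {a..b} \<Longrightarrow>
    (\<Sum>i<n. ennreal (dist (\<gamma> (t i)) (\<gamma> (t (Suc i))))) \<le> C"
  shows "curve_length \<gamma> a b \<le> C"
  unfolding curve_length_def using assms by (intro SUP_least) auto

lemma dist_le_curve_length:
  assumes "a \<le> b"
  shows "ennreal (dist (\<gamma> a) (\<gamma> b)) \<le> curve_length \<gamma> a b"
proof -
  let ?t = "\<lambda>i. if i = (0::nat) then a else b"
  have "(\<Sum>i<1. ennreal (dist (\<gamma> (?t i)) (\<gamma> (?t (Suc i))))) \<le> curve_length \<gamma> a b"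
    using assms by (intro curve_length_ge) (auto simp: mono_on_def)
  then show ?thesis by simp
qed

text \<open>Clamping a partition to \<open>min (t i) s\<close> and \<open>max (t i) s\<close> gives
  partitions of the two halves. A step on one side of \<open>s\<close> contributes zero to the other
  half, and a step across \<open>s\<close> is the triangle inequality, so \<open>s\<close> need not
  be inserted as a partition point.\<close>

lemma curve_length_subadd:
  assumes "a \<le> s" "s \<le> b"
  shows "curve_length \<gamma> a b \<le> curve_length \<gamma> a s + curve_length \<gamma> s b"
proof (rule curve_length_leI)
  fix n and t :: "nat \<Rightarrow> real" assume t: "mono_on {..n} t" "t ` {..n} \<subseteq> {a..b}"
  have step: "dist (\<gamma> (t i)) (\<gamma> (t (Suc i))) \<le>
      dist (\<gamma> (min (t i) s)) (\<gamma> (min (t (Suc i)) s)) + dist (\<gamma> (max (t i) s)) (\<gamma> (max (t (Suc i)) s))"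
    if "i < n" for i
  proof -
    have "t i \<le> t (Suc i)" using t(1) that by (auto simp: mono_on_def)
    then show ?thesis by (auto simp: min_def max_def dist_triangle)
  qed
  have "(\<Sum>i<n. ennreal (dist (\<gamma> (t i)) (\<gamma> (t (Suc i))))) \<le>
     (\<Sum>i<n. ennreal (dist (\<gamma> (min (t i) s)) (\<gamma> (min (t (Suc i)) s)))) +
     (\<Sum>i<n. ennreal (dist (\<gamma> (max (t i) s)) (\<gamma> (max (t (Suc i)) s))))"
    unfolding sum.distrib[symmetric]
    by (intro sum_mono) (auto simp: step ennreal_leI simp flip: ennreal_plus)
  also have "\<dots> \<le> curve_length \<gamma> a s + curve_length \<gamma> s b"
    using t assms
    by (intro add_mono curve_length_ge[of n "\<lambda>i. min (t i) s"] curve_length_ge[of n "\<lambda>i. max (t i) s"])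
       (fastforce simp: mono_on_def min_def max_def image_subset_iff)+
  finally show "(\<Sum>i<n. ennreal (dist (\<gamma> (t i)) (\<gamma> (t (Suc i))))) \<le> curve_length \<gamma> a s + curve_length \<gamma> s b" .
qed

lemma curve_length_superadd:
  assumes "a \<le> s" "s \<le> b"
  shows "curve_length \<gamma> a s + curve_length \<gamma> s b \<le> curve_length \<gamma> a b"
proof -
  let ?S = "\<lambda>n t. \<Sum>i<n. ennreal (dist (\<gamma> (t i)) (\<gamma> (t (Suc i))))"
  have *: "?S n t + ?S m t' \<le> curve_length \<gamma> a b"
    if t: "mono_on {..n} t" "t ` {..n} \<subseteq> {a..s}" and t': "mono_on {..m} t'" "t' ` {..m} \<subseteq> {s..b}"
    for n m :: nat and t t'
  proof -
    \<comment> \<open>The \<open>n + 1\<close> points of \<open>t\<close> are followed by the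
      \<open>m + 1\<close> points of \<open>t'\<close>. The step with index \<open>n\<close> joins
      \<open>t n\<close> to \<open>t' 0\<close>; it is the term dropped in
      \<open>e2\<close>.\<close>
    define w where "w i = (if i \<le> n then t i else t' (i - Suc n))" for i
    have e1: "?S (n + Suc m) w = ?S n w + (\<Sum>i<Suc m. ennreal (dist (\<gamma> (w (n + i))) (\<gamma> (w (Suc (n + i))))))"
      by (induction m) (auto simp: add.assoc)
    have e2: "?S m t' \<le> (\<Sum>i<Suc m. ennreal (dist (\<gamma> (w (n + i))) (\<gamma> (w (Suc (n + i))))))"
      unfolding sum.lessThan_Suc_shift by (auto simp: w_def intro!: add_increasing)
    have e3: "?S n w = ?S n t" by (intro sum.cong) (auto simp: w_def)
    have e4: "?S (n + Suc m) w \<le> curve_length \<gamma> a b"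
    proof (rule curve_length_ge)
      have "w i \<le> w j" if "i \<le> j" "j \<le> n + Suc m" for i j
      proof -
        have "t i \<le> s" if "i \<le> n" using t(2) that by auto
        moreover have "t i \<le> t j" if "j \<le> n" using t(1) that \<open>i \<le> j\<close> by (auto simp: mono_on_def)
        moreover have "t' (i - Suc n) \<le> t' (j - Suc n)" if "\<not> i \<le> n"
          using that \<open>i \<le> j\<close> \<open>j \<le> n + Suc m\<close> by (intro mono_onD[OF t'(1)] diff_le_mono) auto
        moreover have "s \<le> t' (j - Suc n)" if "\<not> j \<le> n" using subsetD[OF t'(2), of "t' (j - Suc n)"] that \<open>j \<le> n + Suc m\<close> by auto
        ultimately show ?thesis using \<open>i \<le> j\<close> by (cases "i \<le> n"; cases "j \<le> n") (auto simp: w_def)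
      qed
      then show "mono_on {..n + Suc m} w" by (auto simp: mono_on_def)
      have "w i \<in> {a..b}" if "i \<le> n + Suc m" for i
      proof (cases "i \<le> n")
        case True
        then show ?thesis using t(2) assms by (fastforce simp: w_def)
      next
        case False
        then have "t' (i - Suc n) \<in> {s..b}" using t'(2) that by (intro subsetD[OF t'(2)] imageI) auto
        then show ?thesis using assms False by (auto simp: w_def)
      qed
      then show "w ` {..n + Suc m} \<subseteq> {a..b}" by auto
    qed
    have "?S n t + ?S m t' \<le> ?S (n + Suc m) w" unfolding e1 e3 by (rule add_left_mono[OF e2])
    then show ?thesis using e4 by (rule order_trans)
  qed
  have *: "(case X of (n, t) \<Rightarrow> ?S n t) + (case Y of (n, t) \<Rightarrow> ?S n t) \<le> curve_length \<gamma> a b"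
    if "X \<in> {(n,t). mono_on {..n} t \<and> t ` {..n} \<subseteq> {a..s}}" "Y \<in> {(n,t). mono_on {..n} t \<and> t ` {..n} \<subseteq> {s..b}}" for X Y
    using that unfolding split_beta mem_Collect_eq by (intro *) auto
  have ne: "{(n,t). mono_on {..n} t \<and> t ` {..n} \<subseteq> {p..q}} \<noteq> {}" if "p \<le> q" for p q :: real
    using that by (auto intro!: exI[of _ "\<lambda>_. p"] simp: mono_on_def)
  show ?thesis
    unfolding curve_length_def[of \<gamma> a s] curve_length_def[of \<gamma> s b]
    by (subst ennreal_SUP_add_left[symmetric, OF ne[OF assms(1)]], rule SUP_least,
        subst ennreal_SUP_add_right[OF ne[OF assms(2)]], rule SUP_least, rule *)
qed

lemma curve_length_add:
  "a \<le> s \<Longrightarrow> s \<le> b \<Longrightarrow> curve_length \<gamma> a b = curve_length \<gamma> a s + curve_length \<gamma> s b"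
  by (intro antisym curve_length_subadd curve_length_superadd)

lemma curve_length_refl: "curve_length \<gamma> a a = 0"
proof -
  have "(\<Sum>i<n. ennreal (dist (\<gamma> (t i)) (\<gamma> (t (Suc i))))) \<le> 0" if "t ` {..n} \<subseteq> {a..a}" for n and t :: "nat \<Rightarrow> real"
  proof -
    have "t i = a" if "i \<le> n" for i using \<open>t ` {..n} \<subseteq> {a..a}\<close> that by auto
    then show ?thesis by simp
  qed
  then show ?thesis
    by (intro antisym curve_length_leI) auto
qed

text \<open>The length of a subcurve is a supremum of sums that depend continuously on the end point.\<close>

lemma curve_length_lsc:
  fixes m :: "real \<Rightarrow> real \<Rightarrow> real"
  assumes cont: "continuous_on {a..b} \<gamma>" and s0: "s0 \<in> {a..b}"
    and p: "\<And>s. s \<in> {a..b} \<Longrightarrow> a \<le> p s \<and> q s \<le> b"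
    and m: "\<And>s t. s \<in> {a..b} \<Longrightarrow> t \<in> {a..b} \<Longrightarrow> m t s \<in> {p s..q s}"
    and m0: "\<And>t. t \<in> {p s0..q s0} \<Longrightarrow> m t s0 = t"
    and mono: "\<And>s t t'. s \<in> {a..b} \<Longrightarrow> t \<le> t' \<Longrightarrow> m t s \<le> m t' s"
    and mcont: "\<And>t. continuous_on {a..b} (m t)"
    and c: "c < curve_length \<gamma> (p s0) (q s0)"
  shows "eventually (\<lambda>s. c < curve_length \<gamma> (p s) (q s)) (at s0 within {a..b})"
proof -
  obtain n t where t: "mono_on {..n} t" "t ` {..n} \<subseteq> {p s0..q s0}"
    "c < (\<Sum>i<n. ennreal (dist (\<gamma> (t i)) (\<gamma> (t (Suc i)))))"
    using c unfolding curve_length_def less_SUP_iff by auto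
  \<comment> \<open>The map \<open>m\<close> carries the fixed partition \<open>t\<close> of the
    interval at \<open>s0\<close> into the interval at \<open>s\<close>; in both applications it is
    a clamp, \<open>min t s\<close> or \<open>max t s\<close>.\<close>
  let ?F = "\<lambda>s. \<Sum>i<n. ennreal (dist (\<gamma> (m (t i) s)) (\<gamma> (m (t (Suc i)) s)))"
  have tab: "t i \<in> {a..b}" if "i \<le> n" for i
    using t(2) that p[OF s0] by fastforce
  have "continuous_on {a..b} ?F"
  proof (intro continuous_on_sum continuous_on_ennreal continuous_on_dist)
    fix i assume i: "i \<in> {..<n}"
    show "continuous_on {a..b} (\<lambda>s. \<gamma> (m (t i) s))" "continuous_on {a..b} (\<lambda>s. \<gamma> (m (t (Suc i)) s))"
      using i tab m p by (auto intro!: continuous_on_compose2[OF cont mcont]) (meson Suc_leI atLeastAtMost_iff less_imp_le_nat order_trans)+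
  qed
  then have "(?F \<longlongrightarrow> ?F s0) (at s0 within {a..b})"
    using s0 by (auto simp: continuous_on_def)
  moreover have "?F s0 = (\<Sum>i<n. ennreal (dist (\<gamma> (t i)) (\<gamma> (t (Suc i)))))"
    using t(2) by (intro sum.cong) (auto simp: m0 image_subset_iff)
  ultimately have "eventually (\<lambda>s. c < ?F s) (at s0 within {a..b})"
    using t(3) by (intro order_tendstoD(1)[of ?F "?F s0"]) auto
  moreover have "eventually (\<lambda>s. s \<in> {a..b}) (at s0 within {a..b})"
    by (simp add: eventually_at_filter)
  ultimately show ?thesis
  proof eventually_elim
    case (elim s)
    have "?F s \<le> curve_length \<gamma> (p s) (q s)"
      using elim(2) t(1) tab m
      by (intro curve_length_ge[of n "\<lambda>i. m (t i) s"]) (auto simp: mono_on_def intro!: mono)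
    then show ?case using elim(1) by simp
  qed
qed

context
  fixes a b :: real and \<gamma> :: "real \<Rightarrow> 'a::metric_space"
  assumes curve: "curve a b \<gamma>"
begin

lemma curve_length_finite: "a \<le> s \<Longrightarrow> s \<le> t \<Longrightarrow> t \<le> b \<Longrightarrow> curve_length \<gamma> s t < \<infinity>"
proof -
  assume "a \<le> s" "s \<le> t" "t \<le> b"
  then have "curve_length \<gamma> s t \<le> curve_length \<gamma> s t + curve_length \<gamma> t b"
    "curve_length \<gamma> s t + curve_length \<gamma> t b = curve_length \<gamma> s b"
    "curve_length \<gamma> s b \<le> curve_length \<gamma> a s + curve_length \<gamma> s b"
    "curve_length \<gamma> a s + curve_length \<gamma> s b = curve_length \<gamma> a b"
    using curve_length_add[of s t b \<gamma>] curve_length_add[of a s b \<gamma>] by auto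
  moreover have "curve_length \<gamma> a b < \<infinity>" using curve by (simp add: curve_def)
  ultimately show ?thesis by (metis order_le_less_trans)
qed

text \<open>The lengths from \<open>a\<close> to \<open>s\<close> and from \<open>s\<close> to
  \<open>b\<close> are both lower semicontinuous in \<open>s\<close> and add up to the finite total
  length. Hence the first is also upper semicontinuous.\<close>

lemma continuous_on_curve_length:
  "continuous_on {a..b} (\<lambda>s. enn2real (curve_length \<gamma> a s))"
  unfolding continuous_on_def
proof (intro ballI order_tendstoI)
  fix s0 y assume s0: "s0 \<in> {a..b}"
  note cont = conjunct1[OF conjunct2[OF curve[unfolded curve_def]]]
  have fin: "curve_length \<gamma> a s < top" "curve_length \<gamma> s b < top" if "s \<in> {a..b}" for s
    using that curve_length_finite[of a s] curve_length_finite[of s b] by auto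
  have ev: "eventually (\<lambda>s. s \<in> {a..b}) (at s0 within {a..b})"
    by (simp add: eventually_at_filter)
  {
    assume y: "y < enn2real (curve_length \<gamma> a s0)"
    show "eventually (\<lambda>s. y < enn2real (curve_length \<gamma> a s)) (at s0 within {a..b})"
    proof (cases "y < 0")
      case True
      then show ?thesis by (auto intro!: always_eventually less_le_trans[OF _ enn2real_nonneg])
    next
      case False
      have "ennreal y < curve_length \<gamma> a s0"
        using y False fin[OF s0] by (metis ennreal_enn2real ennreal_less_iff leI)
      then have "eventually (\<lambda>s. ennreal y < curve_length \<gamma> a s) (at s0 within {a..b})"
        using s0 by (intro curve_length_lsc[where m="\<lambda>t s. min t s" and p="\<lambda>_. a" and q="\<lambda>s. s"] cont)
          (auto simp: min_le_iff_disj intro!: continuous_intros min.mono)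
      then show ?thesis using ev
      proof eventually_elim
        case (elim s)
        then show ?case using False fin[of s] by (metis ennreal_enn2real ennreal_less_iff leI)
      qed
    qed
  }
  {
    assume y: "y > enn2real (curve_length \<gamma> a s0)"
    let ?l = "enn2real (curve_length \<gamma> a b)"
    have eq: "enn2real (curve_length \<gamma> a s) + enn2real (curve_length \<gamma> s b) = ?l" if "s \<in> {a..b}" for s
      using fin[OF that] curve_length_add[of a s b \<gamma>] that by (simp add: enn2real_plus)
    show "eventually (\<lambda>s. y > enn2real (curve_length \<gamma> a s)) (at s0 within {a..b})"
    proof (cases "?l - y < 0")
      case True
      show ?thesis using ev
      proof eventually_elim
        case (elim s)
        then show ?case using True eq[of s] enn2real_nonneg[of "curve_length \<gamma> s b"] by linarith
      qed
    next
      case False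
      have "?l - y < enn2real (curve_length \<gamma> s0 b)" using eq[OF s0] y by simp
      then have "ennreal (?l - y) < curve_length \<gamma> s0 b"
        using False fin[OF s0] by (metis ennreal_enn2real ennreal_less_iff leI)
      then have "eventually (\<lambda>s. ennreal (?l - y) < curve_length \<gamma> s b) (at s0 within {a..b})"
        using s0 by (intro curve_length_lsc[where m="\<lambda>t s. max t s" and p="\<lambda>s. s" and q="\<lambda>_. b"] cont)
          (auto simp: le_max_iff_disj intro!: continuous_intros max.mono)
      then show ?thesis using ev
      proof eventually_elim
        case (elim s)
        then have "?l - y < enn2real (curve_length \<gamma> s b)"
          using False fin[of s] by (metis ennreal_enn2real ennreal_less_iff leI)
        then show ?case using eq[of s] elim by linarith
      qed
    qed
  }
qed

lemma dist_le_curve_length_diff: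
  assumes "s \<in> {a..b}" "t \<in> {a..b}"
  shows "dist (\<gamma> s) (\<gamma> t) \<le> \<bar>enn2real (curve_length \<gamma> a s) - enn2real (curve_length \<gamma> a t)\<bar>"
proof -
  have *: "dist (\<gamma> s) (\<gamma> t) \<le> enn2real (curve_length \<gamma> a t) - enn2real (curve_length \<gamma> a s)"
    if "a \<le> s" "s \<le> t" "t \<le> b" for s t
  proof -
    have fin: "curve_length \<gamma> a s < \<infinity>" "curve_length \<gamma> s t < \<infinity>"
      using curve_length_finite[of a s] curve_length_finite[of s t] that by auto
    have "enn2real (curve_length \<gamma> a t) = enn2real (curve_length \<gamma> a s) + enn2real (curve_length \<gamma> s t)"
      using curve_length_add[of a s t \<gamma>] that fin by (simp add: enn2real_plus)
    moreover have "dist (\<gamma> s) (\<gamma> t) \<le> enn2real (curve_length \<gamma> s t)"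
      using enn2real_mono[OF dist_le_curve_length[OF that(2)], of \<gamma>] fin by simp
    ultimately show ?thesis by linarith
  qed
  show ?thesis
    using *[of s t] *[of t s] assms by (cases "s \<le> t") (auto simp: dist_commute)
qed

text \<open>Continuity of the length and the intermediate value theorem show that the
  \<open>SOME\<close> in \<open>arc_length_reparam\<close> chooses from a nonempty set.\<close>

lemma arc_length_reparam_mem:
  assumes "0 \<le> t" "t \<le> enn2real (curve_length \<gamma> a b)"
  obtains s where "s \<in> {a..b}" "enn2real (curve_length \<gamma> a s) = t" "arc_length_reparam a b \<gamma> t = \<gamma> s"
proof -
  have "\<exists>s\<ge>a. s \<le> b \<and> enn2real (curve_length \<gamma> a s) = t"
    using assms curve by (intro IVT' continuous_on_curve_length) (auto simp: curve_length_refl curve_def)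
  then have "\<exists>s. s \<in> {a..b} \<and> curve_length \<gamma> a s = ennreal t"
    using curve_length_finite[of a] by (metis atLeastAtMost_iff ennreal_enn2real infinity_ennreal_def order_refl)
  from someI_ex[OF this] show ?thesis
    using assms by (intro that[of "SOME s. s \<in> {a..b} \<and> curve_length \<gamma> a s = ennreal t"])
      (auto simp: arc_length_reparam_def)
qed

text \<open>Within arc length \<open>R\<close> of \<open>q\<close> the curve stays within distance
  \<open>R\<close> of a point outside \<open>ball x (2 * R)\<close>, hence outside
  \<open>ball x R\<close>, where \<open>g\<close> is infinite. Nonconstancy makes the total length
  positive, so this happens on a parameter interval of positive measure.\<close>

lemma curve_integral_leaving_ball:
  assumes nonconst: "\<not> \<gamma> constant_on {a..b}" and q: "q \<in> {a..b}" "\<gamma> q \<notin> ball x (2 * R)" and R: "0 < R"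
    and g: "\<And>y. y \<notin> ball x R \<Longrightarrow> g y = \<infinity>"
  shows "curve_integral a b \<gamma> g = \<infinity>"
proof -
  define L where "L = enn2real (curve_length \<gamma> a b)"
  define t0 where "t0 = enn2real (curve_length \<gamma> a q)"
  have le: "enn2real (curve_length \<gamma> a s) \<le> L" if "s \<in> {a..b}" for s
    unfolding L_def using that curve_length_add[of a s b \<gamma>] curve_length_finite[of a b] curve
    by (intro enn2real_mono) (auto simp: curve_def)
  have "L \<noteq> 0"
  proof
    assume "L = 0"
    have 0: "enn2real (curve_length \<gamma> a s) = 0" if "s \<in> {a..b}" for s
      using le[OF that] \<open>L = 0\<close> by (simp add: antisym)
    have "\<gamma> s = \<gamma> q" if "s \<in> {a..b}" for s
      using dist_le_curve_length_diff[OF that q(1)] 0[OF that] 0[OF q(1)] by simp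
    then show False using nonconst by (auto simp: constant_on_def)
  qed
  then have L: "0 < L" by (simp add: L_def order_less_le)
  have t0: "0 \<le> t0" "t0 \<le> L" using le[OF q(1)] by (auto simp: t0_def)
  \<comment> \<open>Clipped to the parameter interval because \<open>q\<close> may be an end of the
    curve; since \<open>0 < L\<close>, at least one side of \<open>t0\<close> remains.\<close>
  define \<alpha> where "\<alpha> = max 0 (t0 - R)"
  define \<beta> where "\<beta> = min L (t0 + R)"
  have \<alpha>\<beta>: "\<alpha> < \<beta>" using t0 L R by (auto simp: \<alpha>_def \<beta>_def)
  have far: "g (arc_length_reparam a b \<gamma> t) = \<infinity>" if t: "t \<in> {\<alpha><..<\<beta>}" for t
  proof -
    have "0 \<le> t" "t \<le> enn2real (curve_length \<gamma> a b)" using t by (auto simp: \<alpha>_def \<beta>_def L_def)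
    then obtain s where s: "s \<in> {a..b}" "enn2real (curve_length \<gamma> a s) = t" "arc_length_reparam a b \<gamma> t = \<gamma> s"
      by (rule arc_length_reparam_mem)
    have "dist (\<gamma> s) (\<gamma> q) < R"
      using dist_le_curve_length_diff[OF s(1) q(1)] t by (auto simp: s(2) t0_def \<alpha>_def \<beta>_def)
    then have "\<gamma> s \<notin> ball x R" using q(2) dist_triangle[of x "\<gamma> q" "\<gamma> s"] by (auto simp: dist_commute)
    then show ?thesis using s g by auto
  qed
  have "\<infinity> = (\<integral>\<^sup>+t. \<infinity> * indicator {\<alpha><..<\<beta>} t \<partial>lborel)"
    using \<alpha>\<beta> by (subst nn_integral_cmult_indicator) (auto simp: ennreal_top_mult)
  also have "\<dots> \<le> curve_integral a b \<gamma> g"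
    unfolding curve_integral_def
    using far by (intro nn_integral_mono) (auto simp: indicator_def L_def[symmetric] \<alpha>_def \<beta>_def)
  finally show ?thesis by (simp add: top.extremum_unique)
qed

end

text \<open>Here \<open>f\<close> is arbitrary because it will be a composition with an arc-length
  parametrization, whose measurability is never established. Scaling the simple functions below
  \<open>f\<close> gives one inequality, which suffices for infinite integrals.\<close>

lemma nn_integral_cmult_top:
  assumes "(\<integral>\<^sup>+x. f x \<partial>M) = \<infinity>" "0 < (e::real)"
  shows "(\<integral>\<^sup>+x. ennreal e * f x \<partial>M) = \<infinity>"
proof -
  have "ennreal e * integral\<^sup>S M s \<le> (\<integral>\<^sup>+x. ennreal e * f x \<partial>M)" if s: "simple_function M s" "s \<le> f" for s
  proof -
    have "ennreal e * integral\<^sup>S M s = (\<integral>\<^sup>Sx. ennreal e * s x \<partial>M)"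
      using s by simp
    also have "\<dots> \<le> (\<integral>\<^sup>+x. ennreal e * f x \<partial>M)"
      unfolding nn_integral_def using s
      by (intro SUP_upper2[where i="\<lambda>x. ennreal e * s x"]) (auto simp: le_fun_def intro!: mult_left_mono)
    finally show ?thesis .
  qed
  then have "(SUP s\<in>{g. simple_function M g \<and> g \<le> f}. ennreal e * integral\<^sup>S M s) \<le> (\<integral>\<^sup>+x. ennreal e * f x \<partial>M)"
    by (intro SUP_least) auto
  then have "ennreal e * (\<integral>\<^sup>+x. f x \<partial>M) \<le> (\<integral>\<^sup>+x. ennreal e * f x \<partial>M)"
    unfolding nn_integral_def[of M f] SUP_mult_left_ennreal .
  then show ?thesis using assms by (simp add: ennreal_mult_top top.extremum_unique)
qed

section \<open>The averaging operator of a doubling domain\<close>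

lemma UN_ball_nat: "(\<Union>n. ball x0 (real (Suc n))) = UNIV"
proof -
  have "\<exists>n. dist x0 x < real (Suc n)" for x
    using reals_Archimedean2[of "dist x0 x"] by (metis less_trans lessI of_nat_less_iff)
  then show ?thesis by auto
qed

text \<open>\<open>N\<close> abstracts the restriction of the ambient measure to \<Omega>; of its
  sigma-algebra only the relatively open sets are asked for. Doubling includes centres on the
  boundary, where the mean deviations of the trace are taken.\<close>

locale doubling_domain =
  fixes N :: "'a::metric_space measure" and \<Omega> :: "'a set" and c :: real
  assumes open_domain: "open \<Omega>" and nonempty: "\<Omega> \<noteq> {}" and compl_nonempty: "- \<Omega> \<noteq> {}"
    and space_N: "space N = \<Omega>"
    and open_sets: "\<And>U. open U \<Longrightarrow> U \<inter> \<Omega> \<in> sets N"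
    and c_pos: "0 < c"
    and doubling: "\<And>x r. x \<in> closure \<Omega> \<Longrightarrow> 0 < r \<Longrightarrow>
      0 < emeasure N (ball x r \<inter> \<Omega>) \<and> emeasure N (ball x r \<inter> \<Omega>) < \<infinity> \<and>
      emeasure N (ball x (2 * r) \<inter> \<Omega>) \<le> ennreal c * emeasure N (ball x r \<inter> \<Omega>)"
begin

definition bdist :: "'a \<Rightarrow> real" where "bdist x = infdist x (- \<Omega>)"

definition vol :: "'a \<Rightarrow> real \<Rightarrow> real" where "vol x r = measure N (ball x r \<inter> \<Omega>)"

lemma bdist_pos: "x \<in> \<Omega> \<Longrightarrow> 0 < bdist x"
  unfolding bdist_def using open_domain compl_nonempty
  by (simp add: infdist_pos_not_in_closed closed_Compl)

lemma bdist_lip: "\<bar>bdist x - bdist y\<bar> \<le> dist x y"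
  unfolding bdist_def by (rule infdist_triangle_abs)

lemma bdist_le: "z \<notin> \<Omega> \<Longrightarrow> bdist x \<le> dist x z"
  unfolding bdist_def by (rule infdist_le) simp

lemma ball_subset: "r \<le> bdist x \<Longrightarrow> ball x r \<subseteq> \<Omega>"
  using bdist_le[of _ x] by fastforce

lemma continuous_bdist: "continuous_on S bdist"
  unfolding bdist_def by (intro continuous_intros)

lemma measurable_ident_borel [measurable]: "(\<lambda>x. x) \<in> measurable N borel"
proof (rule borel_measurableI)
  fix S :: "'a set" assume "open S"
  then show "(\<lambda>x. x) -` S \<inter> space N \<in> sets N" using open_sets[of S] by (simp add: space_N)
qed

lemma borel_measurable_continuous:
  "continuous_on UNIV f \<Longrightarrow> f \<in> borel_measurable N" for f :: "'a \<Rightarrow> 'b::topological_space"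
  using measurable_compose[OF measurable_ident_borel borel_measurable_continuous_onI] .

lemma dist_measurable [measurable]: "(\<lambda>z. dist x z) \<in> borel_measurable N"
  by (intro borel_measurable_continuous continuous_intros)

lemma bdist_measurable [measurable]: "bdist \<in> borel_measurable N"
  by (intro borel_measurable_continuous continuous_bdist)

lemma ball_measurable [measurable]: "Measurable.pred N (\<lambda>z. z \<in> ball x r)"
  by simp

lemma mem_closure: "x \<in> \<Omega> \<Longrightarrow> x \<in> closure \<Omega>"
  using closure_subset by auto

lemma emeasure_ball: "x \<in> closure \<Omega> \<Longrightarrow> emeasure N (ball x r \<inter> \<Omega>) = ennreal (vol x r)"
  using doubling[of x r] unfolding vol_def
  by (cases "0 < r") (auto simp: emeasure_eq_ennreal_measure ball_empty)

lemma ball_fmeasurable: "x \<in> closure \<Omega> \<Longrightarrow> ball x r \<inter> \<Omega> \<in> fmeasurable N"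
  by (simp add: fmeasurable_def emeasure_ball open_sets)

lemma vol_pos: "x \<in> closure \<Omega> \<Longrightarrow> 0 < r \<Longrightarrow> 0 < vol x r"
  using doubling[of x r] emeasure_ball[of x r] by (metis ennreal_less_zero_iff)

lemma vol_nonneg: "0 \<le> vol x r"
  by (simp add: vol_def)

lemma vol_double: "x \<in> closure \<Omega> \<Longrightarrow> 0 < r \<Longrightarrow> vol x (2 * r) \<le> c * vol x r"
  using doubling[of x r] c_pos
  by (simp add: emeasure_ball vol_nonneg ennreal_le_iff flip: ennreal_mult)

lemma vol_double_pow: "x \<in> closure \<Omega> \<Longrightarrow> 0 < r \<Longrightarrow> vol x (2 ^ k * r) \<le> c ^ k * vol x r"
proof (induction k)
  case (Suc k)
  have "vol x (2 * (2 ^ k * r)) \<le> c * vol x (2 ^ k * r)" using Suc by (intro vol_double) auto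
  also have "\<dots> \<le> c * (c ^ k * vol x r)" using Suc c_pos by (intro mult_left_mono) auto
  finally show ?case by (simp add: mult.assoc)
qed simp

lemma vol_mono: "x \<in> closure \<Omega> \<Longrightarrow> ball y s \<subseteq> ball x r \<Longrightarrow> vol y s \<le> vol x r"
  unfolding vol_def by (intro measure_mono_fmeasurable ball_fmeasurable open_sets) auto

text \<open>Centre and radius change together: \<open>k\<close> counts the doublings after which
  \<open>ball x r\<close> contains \<open>ball y s\<close>. The powers \<open>c ^ n\<close> and
  \<open>c ^ j\<close> below arise in this way.\<close>

lemma vol_compare:
  assumes "x \<in> closure \<Omega>" "0 < r" "dist x y + s \<le> 2 ^ k * r"
  shows "vol y s \<le> c ^ k * vol x r"
proof -
  have "ball y s \<subseteq> ball x (2 ^ k * r)"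
  proof
    fix z assume "z \<in> ball y s"
    then show "z \<in> ball x (2 ^ k * r)" using dist_triangle[of x z y] assms(3) by simp
  qed
  then show ?thesis using vol_mono[OF assms(1)] vol_double_pow[OF assms(1,2), of k] order_trans by blast
qed

section \<open>Separability of the domain and measurability on pairs of points\<close>

lemma separated_finite:
  assumes S: "S \<subseteq> \<Omega>" "\<And>x y. x \<in> S \<Longrightarrow> y \<in> S \<Longrightarrow> x \<noteq> y \<Longrightarrow> e \<le> dist x y" and e: "0 < e"
    and x0: "x0 \<in> \<Omega>" and R: "0 < R"
  shows "finite (S \<inter> ball x0 R)"
proof -
  \<comment> \<open>Packing: for centres \<open>s\<close> in \<open>S\<close> within
    \<open>R\<close> of \<open>x0\<close>, the balls of radius \<open>e / 2\<close> are disjoint and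
    lie in \<open>ball x0 (R + e)\<close>. Each has a fixed share of the volume of
    \<open>ball x0 R\<close>, since \<open>dist s x0 + R < 2 * R < 2 ^ k * (e / 2)\<close>.\<close>
  obtain k where k: "4 * R / e < 2 ^ k" using real_arch_pow[of 2 "4 * R / e"] by auto
  have "card F \<le> nat \<lceil>c ^ k * vol x0 (R + e) / vol x0 R\<rceil>" if F: "F \<subseteq> S \<inter> ball x0 R" "finite F" for F
  proof -
    have "vol x0 R \<le> c ^ k * vol s (e / 2)" if s: "s \<in> F" for s
    proof -
      have "dist s x0 + R \<le> 2 ^ k * (e / 2)" using F s k e R by (auto simp: field_simps dist_commute)
      then show ?thesis using s F S e by (intro vol_compare mem_closure) auto
    qed
    then have "card F * vol x0 R \<le> (\<Sum>s\<in>F. c ^ k * vol s (e / 2))"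
      using sum_mono[of F "\<lambda>_. vol x0 R"] by simp
    also have "\<dots> = c ^ k * measure N (\<Union>s\<in>F. ball s (e / 2) \<inter> \<Omega>)"
      unfolding sum_distrib_left[symmetric] vol_def
    proof (subst measure_finite_Union[OF \<open>finite F\<close>])
      show "disjoint_family_on (\<lambda>s. ball s (e / 2) \<inter> \<Omega>) F"
        unfolding disjoint_family_on_def
      proof (intro ballI impI, rule ccontr)
        fix x y assume xy: "x \<in> F" "y \<in> F" "x \<noteq> y" "ball x (e / 2) \<inter> \<Omega> \<inter> (ball y (e / 2) \<inter> \<Omega>) \<noteq> {}"
        then obtain z where "dist x z < e / 2" "dist y z < e / 2" by auto
        then have "dist x y < e" using dist_triangle2[of x y z] by simp
        then show False using S(2)[of x y] xy F by auto
      qed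
    next
      fix s assume "s \<in> F"
      then show "emeasure N (ball s (e / 2) \<inter> \<Omega>) \<noteq> \<infinity>" using F S(1) by (auto simp: emeasure_ball mem_closure)
    qed (auto simp: open_sets)
    also have "\<dots> \<le> c ^ k * vol x0 (R + e)"
    proof -
      have "(\<Union>s\<in>F. ball s (e / 2) \<inter> \<Omega>) \<subseteq> ball x0 (R + e) \<inter> \<Omega>"
      proof safe
        fix s z assume s: "s \<in> F" "z \<in> ball s (e / 2)"
        then show "z \<in> ball x0 (R + e)" using dist_triangle[of x0 z s] F e by auto
      qed
      then have "measure N (\<Union>s\<in>F. ball s (e / 2) \<inter> \<Omega>) \<le> vol x0 (R + e)"
        unfolding vol_def using F(2)
        by (intro measure_mono_fmeasurable ball_fmeasurable mem_closure x0 sets.finite_UN open_sets) auto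
      then show ?thesis using c_pos by (intro mult_left_mono) auto
    qed
    finally have "card F \<le> c ^ k * vol x0 (R + e) / vol x0 R"
      using vol_pos[OF mem_closure[OF x0] R] by (simp add: field_simps)
    then show ?thesis by linarith
  qed
  then show ?thesis by (meson finite_if_finite_subsets_card_bdd)
qed

lemma maximal_separated_subset:
  assumes "0 < (e::real)"
  obtains S where "S \<subseteq> \<Omega>" "\<And>x y. x \<in> S \<Longrightarrow> y \<in> S \<Longrightarrow> x \<noteq> y \<Longrightarrow> e \<le> dist x y"
    "\<And>x. x \<in> \<Omega> \<Longrightarrow> \<exists>p\<in>S. dist x p < e"
proof -
  define P where "P = {S. S \<subseteq> \<Omega> \<and> (\<forall>x\<in>S. \<forall>y\<in>S. x \<noteq> y \<longrightarrow> e \<le> dist x y)}"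
  have "\<exists>M\<in>P. \<forall>X\<in>P. M \<subseteq> X \<longrightarrow> X = M"
  proof (rule subset_Zorn)
    fix C assume C: "subset.chain P C"
    have "\<Union>C \<in> P"
      unfolding P_def
    proof (intro CollectI conjI ballI impI)
      show "\<Union>C \<subseteq> \<Omega>" using C by (auto simp: subset.chain_def P_def)
      fix x y assume "x \<in> \<Union>C" "y \<in> \<Union>C" "x \<noteq> y"
      then obtain X Y where XY: "X \<in> C" "Y \<in> C" "x \<in> X" "y \<in> Y" by blast
      then have "X \<subseteq> Y \<or> Y \<subseteq> X" using C by (auto simp: subset_chain_def)
      then obtain X where "X \<in> C" "x \<in> X" "y \<in> X" using XY by blast
      then show "e \<le> dist x y" using C \<open>x \<noteq> y\<close> by (auto simp: subset.chain_def P_def)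
    qed
    then show "\<exists>U\<in>P. \<forall>X\<in>C. X \<subseteq> U" by blast
  qed
  then obtain S where S: "S \<in> P" "\<And>X. X \<in> P \<Longrightarrow> S \<subseteq> X \<Longrightarrow> X = S" by blast
  show ?thesis
  proof (rule that[of S])
    fix x assume x: "x \<in> \<Omega>"
    show "\<exists>p\<in>S. dist x p < e"
    proof (rule ccontr)
      assume *: "\<not> (\<exists>p\<in>S. dist x p < e)"
      then have "insert x S \<in> P" using S(1) x by (fastforce simp: P_def dist_commute)
      then have "insert x S = S" using S(2) by blast
      then show False using * assms by (metis dist_self insertI1)
    qed
  qed (use S in \<open>auto simp: P_def\<close>)
qed

text \<open>The type is only a metric space, so a countable dense set has to come from doubling:
  maximal separated sets are finite in every ball, hence countable. Density turns an open condition
  on pairs of points into a countable union of rectangles.\<close>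

lemma separable:
  obtains D where "countable D" "D \<subseteq> \<Omega>" "\<And>x e. x \<in> \<Omega> \<Longrightarrow> 0 < e \<Longrightarrow> \<exists>p\<in>D. dist x p < e"
proof -
  have "\<exists>S. countable S \<and> S \<subseteq> \<Omega> \<and> (\<forall>x\<in>\<Omega>. \<exists>p\<in>S. dist x p < e)" if e: "0 < e" for e :: real
  proof -
    obtain S where S: "S \<subseteq> \<Omega>" "\<And>x y. x \<in> S \<Longrightarrow> y \<in> S \<Longrightarrow> x \<noteq> y \<Longrightarrow> e \<le> dist x y"
      "\<And>x. x \<in> \<Omega> \<Longrightarrow> \<exists>p\<in>S. dist x p < e"
      using maximal_separated_subset[OF e] by blast
    obtain x0 where x0: "x0 \<in> \<Omega>" using nonempty by auto
    have "S = (\<Union>n. S \<inter> ball x0 (real (Suc n)))"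
      unfolding Int_UN_distrib[symmetric] UN_ball_nat by simp
    moreover have "finite (S \<inter> ball x0 (real (Suc n)))" for n
      by (rule separated_finite[OF S(1,2) e x0]) auto
    then have "countable (\<Union>n. S \<inter> ball x0 (real (Suc n)))"
      by (meson countable_UN countable_finite countableI_type)
    ultimately show ?thesis using S by auto
  qed
  then obtain S where S: "\<And>e. 0 < e \<Longrightarrow> countable (S e) \<and> S e \<subseteq> \<Omega> \<and> (\<forall>x\<in>\<Omega>. \<exists>p\<in>S e. dist x p < e)"
    by metis
  show ?thesis
  proof (rule that[of "\<Union>n. S (1 / real (Suc n))"])
    have S': "countable (S (1 / real (Suc n)))" "S (1 / real (Suc n)) \<subseteq> \<Omega>" for n
      using S[of "1 / real (Suc n)"] by simp_all
    show "countable (\<Union>n. S (1 / real (Suc n)))" using S' by (intro countable_UN) auto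
    show "(\<Union>n. S (1 / real (Suc n))) \<subseteq> \<Omega>" using S' by blast
    fix x and e :: real assume "x \<in> \<Omega>" "0 < e"
    obtain n where n: "1 / real (Suc n) < e" using reals_Archimedean[OF \<open>0 < e\<close>] by (auto simp: inverse_eq_divide)
    have "\<exists>p\<in>S (1 / real (Suc n)). dist x p < 1 / real (Suc n)" using S[of "1 / real (Suc n)"] \<open>x \<in> \<Omega>\<close> by simp
    then show "\<exists>p\<in>(\<Union>n. S (1 / real (Suc n))). dist x p < e" using n less_trans by blast
  qed
qed

lemma sigma_finite: "sigma_finite_measure N"
proof
  obtain x0 where x0: "x0 \<in> \<Omega>" using nonempty by auto
  have "(\<Union>n. ball x0 (real (Suc n)) \<inter> \<Omega>) = space N"
    unfolding space_N Int_UN_distrib2[symmetric] using UN_ball_nat[of x0] by auto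
  then show "\<exists>A. countable A \<and> A \<subseteq> sets N \<and> \<Union>A = space N \<and> (\<forall>a\<in>A. emeasure N a \<noteq> \<infinity>)"
    by (intro exI[of _ "range (\<lambda>n. ball x0 (real (Suc n)) \<inter> \<Omega>)"])
       (auto simp: open_sets emeasure_ball mem_closure x0)
qed

text \<open>A point \<open>p\<close> of a countable dense set near \<open>x\<close> and a rational
  \<open>q\<close> above \<open>dist p x\<close> separate the variables: the condition becomes
  \<open>dist p x < q\<close> together with \<open>dist p w + q < K * bdist w\<close>, a
  rectangle.\<close>

lemma measurable_dist_less:
  "{p \<in> space (N \<Otimes>\<^sub>M N). dist (fst p) (snd p) < K * bdist (snd p)} \<in> sets (N \<Otimes>\<^sub>M N)" (is "?Q \<in> _")
proof -
  obtain D where D: "countable D" "D \<subseteq> \<Omega>" "\<And>x e. x \<in> \<Omega> \<Longrightarrow> 0 < e \<Longrightarrow> \<exists>p\<in>D. dist x p < e"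
    using separable by blast
  let ?R = "\<lambda>p q. {x \<in> space N. dist p x < q} \<times> {w \<in> space N. dist p w + q < K * bdist w}"
  have "?Q = (\<Union>p\<in>D. \<Union>q\<in>\<rat>. ?R p q)"
  proof (intro equalityI subsetI)
    fix z assume z: "z \<in> ?Q"
    obtain x w where xw: "z = (x, w)" "x \<in> \<Omega>" "w \<in> \<Omega>" "dist x w < K * bdist w"
      using z by (cases z) (auto simp: space_pair_measure space_N)
    \<comment> \<open>A third of the gap: replacing \<open>x\<close> by \<open>p\<close> costs less
      than \<open>e\<close>, and \<open>q\<close> itself is below \<open>e\<close>.\<close>
    define e where "e = (K * bdist w - dist x w) / 3"
    have "0 < e" using xw by (simp add: e_def)
    then obtain p where p: "p \<in> D" "dist x p < e" using D(3)[OF xw(2)] by blast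
    obtain q where q: "q \<in> \<rat>" "dist x p < q" "q < e" using Rats_dense_in_real[OF p(2)] by blast
    have "dist p w + q < K * bdist w"
      using dist_triangle[of p w x] q(3) p(2) xw(4) by (simp add: e_def dist_commute)
    then show "z \<in> (\<Union>p\<in>D. \<Union>q\<in>\<rat>. ?R p q)"
      using p q xw by (auto simp: space_N dist_commute)
  next
    fix z assume "z \<in> (\<Union>p\<in>D. \<Union>q\<in>\<rat>. ?R p q)"
    then obtain p q x w where "z = (x, w)" "x \<in> space N" "w \<in> space N" "dist p x < q" "dist p w + q < K * bdist w"
      by auto
    then show "z \<in> ?Q" using dist_triangle[of x w p] by (auto simp: space_pair_measure dist_commute)
  qed
  also have "\<dots> \<in> sets (N \<Otimes>\<^sub>M N)"
    by (intro sets.countable_UN'' D countable_rat pair_measureI) measurable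
  finally show ?thesis .
qed

text \<open>The volume of \<open>ball w (bdist w)\<close> is the measure of a section of a
  measurable set of pairs, namely the one of \<open>measurable_dist_less\<close> for
  \<open>K = 1\<close> with the coordinates swapped.\<close>

lemma measurable_vol: "(\<lambda>w. vol w (bdist w)) \<in> borel_measurable N"
proof -
  interpret sigma_finite_measure N by (rule sigma_finite)
  have [measurable]: "Measurable.pred (N \<Otimes>\<^sub>M N) (\<lambda>p. dist (fst p) (snd p) < 1 * bdist (snd p))"
    using measurable_dist_less[of 1] by (simp add: pred_def)
  have "Measurable.pred (N \<Otimes>\<^sub>M N) (\<lambda>p. dist (fst (snd p, fst p)) (snd (snd p, fst p)) < 1 * bdist (snd (snd p, fst p)))"
    by (rule measurable_compose[where g="\<lambda>p. dist (fst p) (snd p) < 1 * bdist (snd p)" and f="\<lambda>p. (snd p, fst p)"]) measurable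
  then have Q: "{p \<in> space (N \<Otimes>\<^sub>M N). dist (snd p) (fst p) < bdist (fst p)} \<in> sets (N \<Otimes>\<^sub>M N)" (is "?Q \<in> _")
    by (simp add: pred_def)
  have "(\<lambda>w. enn2real (emeasure N (Pair w -` ?Q))) \<in> borel_measurable N"
    by (intro measurable_compose[OF measurable_emeasure_Pair[OF Q]]) measurable
  moreover have "enn2real (emeasure N (Pair w -` ?Q)) = vol w (bdist w)" if "w \<in> space N" for w
  proof -
    have "Pair w -` ?Q = ball w (bdist w) \<inter> \<Omega>"
      using that by (auto simp: space_pair_measure space_N dist_commute)
    then show ?thesis by (simp add: vol_def measure_def)
  qed
  ultimately show ?thesis by (simp cong: measurable_cong)
qed

text \<open>For fixed \<open>x\<close> the support is a region of cone type. For fixed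
  \<open>w\<close> it is the ball around \<open>w\<close> over which \<open>shadow\<close> spreads
  the mass of \<open>f\<close> at \<open>w\<close>, and the normalization by the volume at the same
  centre makes the integral over \<open>x\<close> bounded by doubling alone.\<close>

definition kern :: "real \<Rightarrow> 'a \<Rightarrow> 'a \<Rightarrow> ennreal" where
  "kern K x w = ennreal (of_bool (dist x w < K * bdist w) / vol w (bdist w))"

definition shadow :: "real \<Rightarrow> ('a \<Rightarrow> ennreal) \<Rightarrow> 'a \<Rightarrow> ennreal" where
  "shadow K f x = (\<integral>\<^sup>+w. kern K x w * f w \<partial>N)"

text \<open>Half ball in the integral, full ball in the denominator: doubling makes this comparable
  to the mean over the half ball, and the denominator has the same form as the one in
  \<open>kern\<close>.\<close>

definition avg :: "('a \<Rightarrow> ennreal) \<Rightarrow> 'a \<Rightarrow> ennreal" where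
  "avg f x = (\<integral>\<^sup>+z. f z * indicator (ball x (bdist x / 2)) z \<partial>N) / ennreal (vol x (bdist x))"

lemma measurable_kern [measurable]: "(\<lambda>(x, w). kern K x w) \<in> borel_measurable (N \<Otimes>\<^sub>M N)"
proof -
  note measurable_vol [measurable]
  have [measurable]: "Measurable.pred (N \<Otimes>\<^sub>M N) (\<lambda>p. dist (fst p) (snd p) < K * bdist (snd p))"
    using measurable_dist_less[of K] by (simp add: pred_def)
  show ?thesis unfolding kern_def split_beta of_bool_def by measurable
qed

lemma measurable_shadow:
  assumes [measurable]: "f \<in> borel_measurable N"
  shows "shadow K f \<in> borel_measurable N"
proof -
  interpret sigma_finite_measure N by (rule sigma_finite)
  show ?thesis unfolding shadow_def[abs_def] by measurable
qed

text \<open>After the exchange of integrals \<open>f w\<close> is multiplied by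
  \<open>vol w (K * bdist w) / vol w (bdist w)\<close>, which \<open>j\<close> doublings
  bound.\<close>

lemma nn_integral_shadow:
  assumes f [measurable]: "f \<in> borel_measurable N" and K: "K \<le> 2 ^ j"
  shows "(\<integral>\<^sup>+x. shadow K f x \<partial>N) \<le> ennreal (c ^ j) * (\<integral>\<^sup>+w. f w \<partial>N)"
proof -
  interpret sigma_finite_measure N by (rule sigma_finite)
  interpret pair_sigma_finite N N ..
  have "(\<integral>\<^sup>+x. shadow K f x \<partial>N) = (\<integral>\<^sup>+w. \<integral>\<^sup>+x. kern K x w * f w \<partial>N \<partial>N)"
    unfolding shadow_def by (rule Fubini') measurable
  also have "\<dots> \<le> (\<integral>\<^sup>+w. ennreal (c ^ j) * f w \<partial>N)"
  proof (rule nn_integral_mono)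
    fix w assume w: "w \<in> space N"
    then have w': "w \<in> closure \<Omega>" "0 < bdist w" by (auto simp: space_N mem_closure bdist_pos)
    have vp: "0 < vol w (bdist w)" using vol_pos w' by simp
    have "(\<integral>\<^sup>+x. kern K x w * f w \<partial>N) =
        (\<integral>\<^sup>+x. (ennreal (1 / vol w (bdist w)) * f w) * indicator (ball w (K * bdist w) \<inter> \<Omega>) x \<partial>N)"
      by (intro nn_integral_cong) (auto simp: kern_def indicator_def space_N dist_commute)
    also have "\<dots> = (ennreal (1 / vol w (bdist w)) * f w) * ennreal (vol w (K * bdist w))"
      by (simp add: nn_integral_cmult_indicator open_sets emeasure_ball w')
    also have "\<dots> = ennreal (vol w (K * bdist w) / vol w (bdist w)) * f w"
      using vp by (simp add: ennreal_mult[symmetric] vol_nonneg mult.assoc mult.left_commute mult.commute)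
    also have "\<dots> \<le> ennreal (c ^ j) * f w"
    proof (intro mult_right_mono ennreal_leI)
      have "vol w (K * bdist w) \<le> c ^ j * vol w (bdist w)"
        using w' K by (intro vol_compare) auto
      then show "vol w (K * bdist w) / vol w (bdist w) \<le> c ^ j" using vp by (simp add: field_simps)
    qed simp
    finally show "(\<integral>\<^sup>+x. kern K x w * f w \<partial>N) \<le> ennreal (c ^ j) * f w" .
  qed
  also have "\<dots> = ennreal (c ^ j) * (\<integral>\<^sup>+w. f w \<partial>N)" by (simp add: nn_integral_cmult)
  finally show ?thesis .
qed

text \<open>On the half ball around \<open>z\<close> the distance to the complement is between 1/2
  and 3/2 of \<open>bdist z\<close>. Hence \<open>dist x w < (2 * k + 1) * (bdist z / 2) \<le> (2 *
  k + 1) * bdist w\<close>, the origin of the aperture, and \<open>ball w (bdist w)\<close> fits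
  into the double of \<open>ball z (bdist z)\<close>, the origin of the factor
  \<open>c\<close>.\<close>

lemma avg_le_shadow:
  assumes f [measurable]: "f \<in> borel_measurable N" and x: "x \<in> \<Omega>" and z: "z \<in> \<Omega>"
    and d: "dist x z \<le> k * bdist z" and k: "0 \<le> k"
  shows "avg f z \<le> ennreal c * shadow (2 * k + 1) f x"
proof -
  have vz: "0 < vol z (bdist z)" using vol_pos mem_closure bdist_pos z by auto
  have [measurable]: "kern K x \<in> borel_measurable N" for K
    using measurable_compose[OF measurable_Pair1'[of x N N] measurable_kern[of K]] x by (simp add: space_N)
  have "avg f z = (\<integral>\<^sup>+w. f w * indicator (ball z (bdist z / 2)) w / ennreal (vol z (bdist z)) \<partial>N)"
    unfolding avg_def by (rule nn_integral_divide[symmetric]) measurable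
  also have "\<dots> \<le> (\<integral>\<^sup>+w. ennreal c * (kern (2 * k + 1) x w * f w) \<partial>N)"
  proof (rule nn_integral_mono)
    fix w assume "w \<in> space N"
    then have w: "w \<in> \<Omega>" by (simp add: space_N)
    show "f w * indicator (ball z (bdist z / 2)) w / ennreal (vol z (bdist z))
        \<le> ennreal c * (kern (2 * k + 1) x w * f w)"
    proof (cases "dist z w < bdist z / 2")
      case True
      have bw: "bdist z / 2 \<le> bdist w" "bdist w \<le> 3 / 2 * bdist z"
        using bdist_lip[of z w] True by auto
      have "dist x w < k * bdist z + bdist z / 2" using dist_triangle[of x w z] d True by linarith
      also have "\<dots> \<le> (2 * k + 1) * bdist w"
        using bw(1) k mult_left_mono[of "bdist z / 2" "bdist w" "2 * k + 1"] by (simp add: algebra_simps)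
      finally have xw: "dist x w < (2 * k + 1) * bdist w" .
      have "vol w (bdist w) \<le> c ^ 1 * vol z (bdist z)"
        using True bw bdist_pos[OF z] z by (intro vol_compare mem_closure) auto
      moreover have "0 < vol w (bdist w)" using vol_pos mem_closure bdist_pos w by auto
      ultimately have "1 / vol z (bdist z) \<le> c * (1 / vol w (bdist w))"
        using vz by (simp add: field_simps)
      then have "ennreal (1 / vol z (bdist z)) \<le> ennreal c * ennreal (1 / vol w (bdist w))"
        using c_pos by (simp add: ennreal_mult[symmetric] vol_nonneg ennreal_leI)
      then have "ennreal (1 / vol z (bdist z)) * f w \<le> (ennreal c * ennreal (1 / vol w (bdist w))) * f w"
        by (rule mult_right_mono) simp
      moreover have "f w / ennreal (vol z (bdist z)) = ennreal (1 / vol z (bdist z)) * f w"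
        using vz by (simp add: divide_ennreal_def inverse_ennreal mult.commute inverse_eq_divide)
      ultimately show ?thesis using True xw
        by (simp add: kern_def mult.assoc)
    qed simp
  qed
  also have "\<dots> = ennreal c * shadow (2 * k + 1) f x"
    unfolding shadow_def by (rule nn_integral_cmult) measurable
  finally show ?thesis .
qed

end

section \<open>Smoothing at the scale of the distance to the boundary\<close>

text \<open>The neighbourhood of \<open>t\<close> has no uniform size, and only pairs containing
  \<open>t\<close> are compared. This is enough for Bolzano's bisection principle: a short interval
  around \<open>t\<close> is split at \<open>t\<close>, and the bounds on adjacent intervals
  add.\<close>

lemma locally_lipschitz_interval:
  fixes h :: "real \<Rightarrow> real"
  assumes "a \<le> b" and "\<And>t. a \<le> t \<Longrightarrow> t \<le> b \<Longrightarrow> \<exists>d>0. \<forall>s. a \<le> s \<and> s \<le> b \<and> \<bar>s - t\<bar> < d \<longrightarrow> \<bar>h s - h t\<bar> \<le> K * \<bar>s - t\<bar>"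
  shows "\<bar>h b - h a\<bar> \<le> K * (b - a)"
proof -
  have "a \<le> a \<and> b \<le> b \<longrightarrow> \<bar>h b - h a\<bar> \<le> K * (b - a)"
  proof (rule Bolzano[OF \<open>a \<le> b\<close>, where P="\<lambda>p q. a \<le> p \<and> q \<le> b \<longrightarrow> \<bar>h q - h p\<bar> \<le> K * (q - p)"])
    fix p q r assume "p \<le> q" "q \<le> r"
      "a \<le> p \<and> q \<le> b \<longrightarrow> \<bar>h q - h p\<bar> \<le> K * (q - p)" "a \<le> q \<and> r \<le> b \<longrightarrow> \<bar>h r - h q\<bar> \<le> K * (r - q)"
    then show "a \<le> p \<and> r \<le> b \<longrightarrow> \<bar>h r - h p\<bar> \<le> K * (r - p)" by (auto simp: algebra_simps abs_if split: if_splits)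
  next
    fix t assume t: "a \<le> t" "t \<le> b"
    then obtain d where d: "d > 0" "\<And>s. a \<le> s \<Longrightarrow> s \<le> b \<Longrightarrow> \<bar>s - t\<bar> < d \<Longrightarrow> \<bar>h s - h t\<bar> \<le> K * \<bar>s - t\<bar>"
      using assms(2) by blast
    show "\<exists>d>0. \<forall>p q. p \<le> t \<and> t \<le> q \<and> q - p < d \<longrightarrow> a \<le> p \<and> q \<le> b \<longrightarrow> \<bar>h q - h p\<bar> \<le> K * (q - p)"
    proof (intro exI[of _ d] conjI allI impI d)
      fix p q assume "p \<le> t \<and> t \<le> q \<and> q - p < d" "a \<le> p \<and> q \<le> b"
      then have "\<bar>h q - h t\<bar> \<le> K * (q - t)" "\<bar>h p - h t\<bar> \<le> K * (t - p)"
        using d(2)[of q] d(2)[of p] t by auto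
      then show "\<bar>h q - h p\<bar> \<le> K * (q - p)" by (auto simp: algebra_simps abs_if split: if_splits)
    qed
  qed
  then show ?thesis by simp
qed

text \<open>\<open>n\<close> counts the doublings from radius \<open>\<eta> * bdist x / 2\<close> to
  radius \<open>bdist x\<close>. The bound 1/6 keeps \<open>ball x (3 * \<eta> * bdist x)\<close>
  inside the half ball on which \<open>avg\<close> is taken.\<close>

locale smoothing = doubling_domain +
  fixes u :: "'a \<Rightarrow> real" and \<eta> :: real and n :: nat
  assumes u: "integrable N u" and \<eta>: "0 < \<eta>" "\<eta> \<le> 1 / 6" "2 \<le> 2 ^ n * \<eta>"
begin

definition bump :: "'a \<Rightarrow> 'a \<Rightarrow> real" where
  "bump x z = max 0 (\<eta> * bdist x - dist x z)"

definition smooth :: "'a \<Rightarrow> real" where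
  "smooth x = (\<integral>z. u z * bump x z \<partial>N) / (\<integral>z. bump x z \<partial>N)"

definition dev :: "'a \<Rightarrow> real \<Rightarrow> real \<Rightarrow> real" where
  "dev x r k = (\<integral>z. indicator (ball x r) z * \<bar>u z - k\<bar> \<partial>N)"

lemma measurable_u [measurable]: "u \<in> borel_measurable N"
  using u by auto

lemma integrable_ball: "x \<in> closure \<Omega> \<Longrightarrow> integrable N (indicator (ball x r) :: 'a \<Rightarrow> real)"
proof -
  assume x: "x \<in> closure \<Omega>"
  have "integrable N (indicator (ball x r \<inter> \<Omega>) :: 'a \<Rightarrow> real)"
    using open_sets[of "ball x r"] emeasure_ball[OF x, of r] by (intro integrable_real_indicator) auto
  then show ?thesis by (rule Bochner_Integration.integrable_cong[THEN iffD1, rotated 2]) (auto simp: space_N indicator_def)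
qed

lemma integral_ball: "(\<integral>z. indicator (ball x r) z \<partial>N) = vol x r"
  by (simp add: vol_def space_N Int_commute)

lemma integrable_dev: "x \<in> closure \<Omega> \<Longrightarrow> integrable N (\<lambda>z. indicator (ball x r) z * \<bar>u z - k\<bar>)"
  by (rule Bochner_Integration.integrable_bound[of N "\<lambda>z. \<bar>u z\<bar> + \<bar>k\<bar> * indicator (ball x r) z"],
      intro Bochner_Integration.integrable_add integrable_abs u integrable_mult_right integrable_ball)
     (auto simp: indicator_def)

lemma dev_nonneg: "0 \<le> dev x r k"
  unfolding dev_def by (intro Bochner_Integration.integral_nonneg) auto

lemma dev_mono: "x \<in> closure \<Omega> \<Longrightarrow> y \<in> closure \<Omega> \<Longrightarrow> ball x r \<subseteq> ball y s \<Longrightarrow> dev x r k \<le> dev y s k"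
  unfolding dev_def
  by (intro Bochner_Integration.integral_mono integrable_dev) (auto simp: indicator_def)

lemma dev_shift:
  assumes "x \<in> closure \<Omega>"
  shows "dev x r l \<le> dev x r k + \<bar>k - l\<bar> * vol x r"
proof -
  have "dev x r l \<le> (\<integral>z. indicator (ball x r) z * \<bar>u z - k\<bar> + \<bar>k - l\<bar> * indicator (ball x r) z \<partial>N)"
    unfolding dev_def
    by (intro Bochner_Integration.integral_mono integrable_dev Bochner_Integration.integrable_add integrable_mult_right integrable_ball assms)
       (auto simp: indicator_def)
  also have "\<dots> = dev x r k + \<bar>k - l\<bar> * vol x r"
    unfolding dev_def
    using integrable_dev[OF assms, of r k] integrable_ball[OF assms, of r] integral_ball[of x r] by simp
  finally show ?thesis .
qed

lemma measurable_bump [measurable]: "bump x \<in> borel_measurable N"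
  unfolding bump_def[abs_def] by measurable

lemma bump_nonneg: "0 \<le> bump x z"
  by (simp add: bump_def)

lemma bump_le: "x \<in> \<Omega> \<Longrightarrow> bump x z \<le> \<eta> * bdist x * indicator (ball x (\<eta> * bdist x)) z"
  using bdist_pos[of x] \<eta> by (auto simp: bump_def indicator_def)

lemma integrable_bump: "x \<in> \<Omega> \<Longrightarrow> integrable N (bump x)"
  by (rule Bochner_Integration.integrable_bound[of N "\<lambda>z. \<eta> * bdist x * indicator (ball x (\<eta> * bdist x)) z"])
     (auto intro!: integrable_mult_right integrable_ball mem_closure order_trans[OF bump_le] simp: bump_nonneg)

lemma integrable_u_bump: "x \<in> \<Omega> \<Longrightarrow> integrable N (\<lambda>z. u z * bump x z)"
proof (rule Bochner_Integration.integrable_bound[of N "\<lambda>z. \<eta> * bdist x * \<bar>u z\<bar>"])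
  assume x: "x \<in> \<Omega>"
  have "bump x z \<le> \<eta> * bdist x" for z
    using bdist_pos[OF x] \<eta> by (auto simp: bump_def)
  then show "AE z in N. norm (u z * bump x z) \<le> norm (\<eta> * bdist x * \<bar>u z\<bar>)"
    using bdist_pos[OF x] \<eta> by (auto simp: abs_mult bump_nonneg mult.commute intro!: mult_left_mono)
qed (auto intro!: integrable_mult_right integrable_abs u)

text \<open>On the ball of half the radius the bump is at least half its height
  \<open>\<eta> * bdist x\<close>, and \<open>n\<close> doublings compare that ball with
  \<open>ball x (bdist x)\<close>.\<close>

lemma integral_bump_ge:
  assumes x: "x \<in> \<Omega>"
  shows "\<eta> * bdist x / 2 * (vol x (bdist x) / c ^ n) \<le> (\<integral>z. bump x z \<partial>N)"
proof -
  have d: "0 < bdist x" using bdist_pos x by auto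
  have "vol x (bdist x) \<le> c ^ n * vol x (\<eta> * bdist x / 2)"
    using d \<eta> x mult_right_mono[OF \<eta>(3), of "bdist x / 2"]
    by (intro vol_compare mem_closure) (auto simp: algebra_simps)
  then have "\<eta> * bdist x / 2 * (vol x (bdist x) / c ^ n) \<le> \<eta> * bdist x / 2 * vol x (\<eta> * bdist x / 2)"
    using d \<eta> c_pos by (intro mult_left_mono) (auto simp: field_simps)
  also have "\<dots> = (\<integral>z. \<eta> * bdist x / 2 * indicator (ball x (\<eta> * bdist x / 2)) z \<partial>N)"
    by (simp only: integral_mult_right_zero integral_ball)
  also have "\<dots> \<le> (\<integral>z. bump x z \<partial>N)"
    by (intro Bochner_Integration.integral_mono integrable_mult_right integrable_ball integrable_bump mem_closure x)
       (auto simp: indicator_def bump_def max_def)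
  finally show ?thesis .
qed

lemma integral_bump_pos:
  assumes x: "x \<in> \<Omega>"
  shows "0 < (\<integral>z. bump x z \<partial>N)"
  using vol_pos[OF mem_closure[OF x] bdist_pos[OF x]] bdist_pos[OF x] \<eta> c_pos
  by (intro less_le_trans[OF _ integral_bump_ge[OF x]]) auto

text \<open>The convolution reproduces constants, so any \<open>k\<close> may be subtracted from
  \<open>u\<close>. Later \<open>k\<close> is the constant of a Poincare inequality, the value
  \<open>smooth y\<close>, zero, or the boundary value.\<close>

lemma smooth_diff_const:
  assumes x: "x \<in> \<Omega>"
  shows "(smooth x - k) * (\<integral>z. bump x z \<partial>N) = (\<integral>z. (u z - k) * bump x z \<partial>N)"
  using integral_bump_pos[OF x] integrable_bump[OF x] integrable_u_bump[OF x]
  by (simp add: smooth_def left_diff_distrib)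

lemma smooth_dev:
  assumes x: "x \<in> \<Omega>"
  shows "\<bar>smooth x - k\<bar> * vol x (bdist x) \<le> 2 * c ^ n * dev x (\<eta> * bdist x) k"
proof -
  have d: "0 < bdist x" using bdist_pos x by auto
  have "\<bar>smooth x - k\<bar> * (\<eta> * bdist x / 2 * (vol x (bdist x) / c ^ n)) \<le> \<bar>smooth x - k\<bar> * (\<integral>z. bump x z \<partial>N)"
    by (intro mult_left_mono integral_bump_ge x) auto
  also have "\<dots> = \<bar>\<integral>z. (u z - k) * bump x z \<partial>N\<bar>"
    using integral_bump_pos[OF x] by (simp add: smooth_diff_const[OF x, symmetric] abs_mult)
  also have "\<dots> \<le> (\<integral>z. \<bar>(u z - k) * bump x z\<bar> \<partial>N)" by (rule integral_abs_bound)
  also have "\<dots> \<le> (\<integral>z. \<eta> * bdist x * (indicator (ball x (\<eta> * bdist x)) z * \<bar>u z - k\<bar>) \<partial>N)"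
  proof (intro Bochner_Integration.integral_mono integrable_mult_right integrable_dev mem_closure x integrable_abs)
    show "integrable N (\<lambda>z. (u z - k) * bump x z)"
      using integrable_bump[OF x] integrable_u_bump[OF x] by (simp add: left_diff_distrib)
    fix z
    show "\<bar>(u z - k) * bump x z\<bar> \<le> \<eta> * bdist x * (indicator (ball x (\<eta> * bdist x)) z * \<bar>u z - k\<bar>)"
      using mult_left_mono[OF bump_le[OF x, of z], of "\<bar>u z - k\<bar>"] by (simp add: abs_mult bump_nonneg mult.commute mult.left_commute)
  qed
  also have "\<dots> = \<eta> * bdist x * dev x (\<eta> * bdist x) k" by (simp add: dev_def)
  finally have "(\<eta> * bdist x) * (\<bar>smooth x - k\<bar> * vol x (bdist x)) \<le> (\<eta> * bdist x) * (2 * c ^ n * dev x (\<eta> * bdist x) k)"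
    using c_pos by (simp add: field_simps)
  then show ?thesis using d \<eta> by simp
qed

text \<open>The factor \<open>4 * c ^ n / \<eta>\<close> combines the lower bound for the integral
  of the bump with the Lipschitz constant 2 of the bumps. The bracket is the cost of replacing
  \<open>smooth y\<close> by a free constant \<open>k\<close>.\<close>

definition lip_const :: real where "lip_const = 4 * c ^ n * (1 + 2 * c ^ n * c) / \<eta>"

lemma lip_const_pos: "0 < lip_const"
  using c_pos \<eta> by (simp add: lip_const_def add_pos_pos)

text \<open>The integral identity leads to \<open>dev x R (smooth y)\<close>.
  \<open>dev_shift\<close> trades \<open>smooth y\<close> for an arbitrary \<open>k\<close>, and the
  resulting error \<open>\<bar>smooth y - k\<bar>\<close> is controlled by \<open>smooth_dev\<close>
  at \<open>y\<close>, whose ball lies in \<open>ball x R\<close>.\<close>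

lemma smooth_lipschitz:
  assumes x: "x \<in> \<Omega>" and y: "y \<in> \<Omega>" and xy: "dist x y \<le> \<eta> * bdist x"
  shows "\<bar>smooth x - smooth y\<bar> * (bdist x * vol x (bdist x)) \<le> lip_const * dist x y * dev x (3 * \<eta> * bdist x) k"
proof -
  define d where "d = dist x y"
  \<comment> \<open>The 3 is one unit \<open>\<eta> * bdist x\<close> for the distance to
    \<open>y\<close> and two for the radius of the bump at \<open>y\<close>, because
    \<open>bdist y \<le> 2 * bdist x\<close>.\<close>
  define R where "R = 3 * \<eta> * bdist x"
  define I where "I = dev x R k"
  define m where "m = vol x (bdist x)"
  have dx: "0 < bdist x" and dy: "0 < bdist y" using bdist_pos x y by auto
  have dyx: "bdist y \<le> (1 + \<eta>) * bdist x" "(1 - \<eta>) * bdist x \<le> bdist y"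
    using bdist_lip[of x y] xy by (auto simp: algebra_simps)
  have e1: "\<eta> * bdist x \<le> bdist x / 6" using \<eta> dx by (simp add: field_simps)
  have ydx: "bdist y \<le> 2 * bdist x" "2 / 3 * bdist x \<le> bdist y"
    using dyx e1 by (auto simp: algebra_simps)
  have e3: "3 * \<eta> * bdist x \<le> bdist x" using e1 dx by simp
  have m: "0 < m" using vol_pos mem_closure x dx by (auto simp: m_def)
  have my: "m \<le> c * vol y (bdist y)"
    using vol_compare[of y "bdist y" x "bdist x" 1] y dy xy ydx e1 mem_closure by (auto simp: m_def dist_commute)
  have By: "ball y (\<eta> * bdist y) \<subseteq> ball x R"
  proof
    fix z assume "z \<in> ball y (\<eta> * bdist y)"
    moreover have "\<eta> * bdist y \<le> \<eta> * (2 * bdist x)" using ydx(1) \<eta> by (intro mult_left_mono) auto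
    ultimately show "z \<in> ball x R"
      using dist_triangle[of x z y] xy by (auto simp: R_def)
  qed
  have "\<bar>smooth y - k\<bar> * vol y (bdist y) \<le> 2 * c ^ n * I"
    using smooth_dev[OF y, of k] dev_mono[OF mem_closure[OF y] mem_closure[OF x] By, of k] c_pos
    unfolding I_def by (smt (verit) mult_left_mono zero_less_power)
  then have "\<bar>smooth y - k\<bar> * (c * vol y (bdist y)) \<le> 2 * c ^ n * c * I"
    using c_pos by (simp add: mult_left_mono algebra_simps)
  then have sy: "\<bar>smooth y - k\<bar> * m \<le> 2 * c ^ n * c * I"
    using mult_left_mono[OF my, of "\<bar>smooth y - k\<bar>"] by simp
  have vR: "vol x R \<le> m"
    unfolding m_def R_def using e3 x by (intro vol_mono mem_closure) auto
  have "dev x R (smooth y) \<le> I + \<bar>smooth y - k\<bar> * vol x R"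
    using dev_shift[OF mem_closure[OF x], of R "smooth y" k] by (simp add: I_def abs_minus_commute)
  also have "\<dots> \<le> I + \<bar>smooth y - k\<bar> * m" using vR by (intro add_left_mono mult_left_mono) auto
  also have "\<dots> \<le> (1 + 2 * c ^ n * c) * I" using sy by (simp add: algebra_simps)
  finally have dv: "dev x R (smooth y) \<le> (1 + 2 * c ^ n * c) * I" .
  have "\<bar>smooth x - smooth y\<bar> * (\<eta> * bdist x / 2 * (m / c ^ n)) \<le> \<bar>smooth x - smooth y\<bar> * (\<integral>z. bump x z \<partial>N)"
    unfolding m_def by (intro mult_left_mono integral_bump_ge x) auto
  also have "\<dots> = \<bar>(\<integral>z. (u z - smooth y) * bump x z \<partial>N) - (\<integral>z. (u z - smooth y) * bump y z \<partial>N)\<bar>"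
    using integral_bump_pos[OF x]
    by (simp add: smooth_diff_const[OF x, symmetric] smooth_diff_const[OF y, symmetric] abs_mult)
  also have "\<dots> = \<bar>\<integral>z. (u z - smooth y) * (bump x z - bump y z) \<partial>N\<bar>"
    using integrable_bump[OF x] integrable_u_bump[OF x] integrable_bump[OF y] integrable_u_bump[OF y]
    by (simp add: left_diff_distrib right_diff_distrib)
  also have "\<dots> \<le> (\<integral>z. \<bar>(u z - smooth y) * (bump x z - bump y z)\<bar> \<partial>N)" by (rule integral_abs_bound)
  also have "\<dots> \<le> (\<integral>z. 2 * d * (indicator (ball x R) z * \<bar>u z - smooth y\<bar>) \<partial>N)"
  proof (intro Bochner_Integration.integral_mono integrable_mult_right integrable_dev mem_closure x integrable_abs)
    show "integrable N (\<lambda>z. (u z - smooth y) * (bump x z - bump y z))"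
      using integrable_bump[OF x] integrable_u_bump[OF x] integrable_bump[OF y] integrable_u_bump[OF y]
      by (simp add: left_diff_distrib right_diff_distrib)
    fix z
    have "\<bar>bump x z - bump y z\<bar> \<le> 2 * d * indicator (ball x R) z"
    proof (cases "z \<in> ball x R")
      case True
      have "\<bar>bump x z - bump y z\<bar> \<le> \<bar>(\<eta> * bdist x - dist x z) - (\<eta> * bdist y - dist y z)\<bar>"
        by (auto simp: bump_def)
      also have "\<dots> \<le> \<bar>\<eta> * (bdist x - bdist y)\<bar> + \<bar>dist x z - dist y z\<bar>" by (simp add: algebra_simps)
      also have "\<bar>\<eta> * (bdist x - bdist y)\<bar> \<le> 1 * d"
        unfolding abs_mult using \<eta> bdist_lip[of x y] by (intro mult_mono) (auto simp: d_def)
      also have "\<bar>dist x z - dist y z\<bar> \<le> d"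
        using dist_triangle[of x z y] dist_triangle[of y z x] by (auto simp: d_def dist_commute)
      finally show ?thesis using True by simp
    next
      case False
      then have "z \<notin> ball y (\<eta> * bdist y)" using By by auto
      moreover have "\<eta> * bdist x \<le> R" using \<eta> dx by (simp add: R_def)
      then have "z \<notin> ball x (\<eta> * bdist x)" using False by auto
      ultimately show ?thesis using False by (auto simp: bump_def)
    qed
    from mult_left_mono[OF this, of "\<bar>u z - smooth y\<bar>"]
    show "\<bar>(u z - smooth y) * (bump x z - bump y z)\<bar> \<le> 2 * d * (indicator (ball x R) z * \<bar>u z - smooth y\<bar>)"
      by (simp add: abs_mult mult.commute mult.left_commute)
  qed
  also have "\<dots> = 2 * d * dev x R (smooth y)" by (simp add: dev_def)
  also have "\<dots> \<le> 2 * d * ((1 + 2 * c ^ n * c) * I)"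
    using dv by (intro mult_left_mono) (auto simp: d_def)
  finally have "\<bar>smooth x - smooth y\<bar> * (bdist x * m) * \<eta> \<le> 4 * c ^ n * (1 + 2 * c ^ n * c) * d * I"
    using c_pos by (simp add: field_simps)
  then show ?thesis unfolding lip_const_def I_def R_def d_def m_def using \<eta> by (simp add: field_simps)
qed

lemma ennreal_dev:
  assumes "x \<in> closure \<Omega>"
  shows "ennreal (dev x r k) = (\<integral>\<^sup>+z. ennreal \<bar>u z - k\<bar> * indicator (ball x r) z \<partial>N)"
  unfolding dev_def using integrable_dev[OF assms, of r k]
  by (subst nn_integral_eq_integral[symmetric]) (auto intro!: nn_integral_cong simp: indicator_def)

lemma smooth_le_avg:
  assumes x: "x \<in> \<Omega>"
  shows "ennreal \<bar>smooth x - k\<bar> \<le> ennreal (2 * c ^ n) * avg (\<lambda>z. ennreal \<bar>u z - k\<bar>) x"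
proof -
  have d: "0 < bdist x" using bdist_pos x by auto
  have v: "0 < vol x (bdist x)" using vol_pos mem_closure x d by auto
  have "dev x (\<eta> * bdist x) k \<le> dev x (bdist x / 2) k"
  proof (intro dev_mono mem_closure x subset_ball)
    show "\<eta> * bdist x \<le> bdist x / 2" using \<eta> d by (simp add: field_simps)
  qed
  then have "\<bar>smooth x - k\<bar> * vol x (bdist x) \<le> 2 * c ^ n * dev x (bdist x / 2) k"
    using smooth_dev[OF x, of k] c_pos by (smt (verit) mult_left_mono zero_less_power)
  then have "\<bar>smooth x - k\<bar> \<le> 2 * c ^ n * (dev x (bdist x / 2) k / vol x (bdist x))"
    using v by (simp add: field_simps)
  then have "ennreal \<bar>smooth x - k\<bar> \<le> ennreal (2 * c ^ n) * (ennreal (dev x (bdist x / 2) k) / ennreal (vol x (bdist x)))"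
    using c_pos v by (simp add: divide_ennreal dev_nonneg ennreal_mult[symmetric] ennreal_leI)
  then show ?thesis by (simp add: avg_def ennreal_dev mem_closure x)
qed

lemma smooth_le_shadow:
  assumes x: "x \<in> \<Omega>"
  shows "ennreal \<bar>smooth x - k\<bar> \<le> ennreal (2 * c ^ n * c) * shadow 1 (\<lambda>z. ennreal \<bar>u z - k\<bar>) x"
proof -
  have "ennreal \<bar>smooth x - k\<bar> \<le> ennreal (2 * c ^ n) * avg (\<lambda>z. ennreal \<bar>u z - k\<bar>) x"
    by (rule smooth_le_avg[OF x])
  also have "\<dots> \<le> ennreal (2 * c ^ n) * (ennreal c * shadow (2 * 0 + 1) (\<lambda>z. ennreal \<bar>u z - k\<bar>) x)"
    using x by (intro mult_left_mono avg_le_shadow) auto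
  finally show ?thesis using c_pos by (simp add: ennreal_mult mult.assoc)
qed

lemma nn_integral_smooth:
  "(\<integral>\<^sup>+x. ennreal \<bar>smooth x\<bar> \<partial>N) \<le> ennreal (2 * c ^ n * c) * (\<integral>\<^sup>+x. ennreal \<bar>u x\<bar> \<partial>N)"
proof -
  have "(\<integral>\<^sup>+x. ennreal \<bar>smooth x\<bar> \<partial>N) \<le> (\<integral>\<^sup>+x. ennreal (2 * c ^ n * c) * shadow 1 (\<lambda>z. ennreal \<bar>u z\<bar>) x \<partial>N)"
    using smooth_le_shadow[of _ 0] by (intro nn_integral_mono) (simp add: space_N)
  also have "\<dots> = ennreal (2 * c ^ n * c) * (\<integral>\<^sup>+x. shadow 1 (\<lambda>z. ennreal \<bar>u z\<bar>) x \<partial>N)"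
    by (intro nn_integral_cmult measurable_shadow) measurable
  also have "\<dots> \<le> ennreal (2 * c ^ n * c) * (ennreal (c ^ 0) * (\<integral>\<^sup>+x. ennreal \<bar>u x\<bar> \<partial>N))"
    by (intro mult_left_mono nn_integral_shadow) auto
  finally show ?thesis by simp
qed

text \<open>As \<open>x\<close> is not in the open set \<Omega>, every \<open>y\<close> in
  \<open>ball x r\<close> has \<open>bdist y \<le> dist x y < r\<close>. The half ball around
  \<open>y\<close> therefore stays in \<open>ball x (2 * r)\<close>, and cutting
  \<open>\<bar>u - k\<bar>\<close> off outside that ball does not change its average at
  \<open>y\<close>.\<close>

lemma nn_integral_smooth_boundary:
  assumes x: "x \<in> frontier \<Omega>"
  shows "(\<integral>\<^sup>+y. ennreal \<bar>smooth y - k\<bar> * indicator (ball x r) y \<partial>N) \<le>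
    ennreal (2 * c ^ n * c) * (\<integral>\<^sup>+y. ennreal \<bar>u y - k\<bar> * indicator (ball x (2 * r)) y \<partial>N)"
proof -
  have xn: "x \<notin> \<Omega>" using x open_domain by (auto simp: frontier_def interior_open)
  define f where "f z = ennreal \<bar>u z - k\<bar> * indicator (ball x (2 * r)) z" for z
  have [measurable]: "f \<in> borel_measurable N" unfolding f_def[abs_def] by measurable
  have "(\<integral>\<^sup>+y. ennreal \<bar>smooth y - k\<bar> * indicator (ball x r) y \<partial>N) \<le> (\<integral>\<^sup>+y. ennreal (2 * c ^ n * c) * shadow 1 f y \<partial>N)"
  proof (rule nn_integral_mono)
    fix y assume "y \<in> space N"
    then have y: "y \<in> \<Omega>" by (simp add: space_N)
    show "ennreal \<bar>smooth y - k\<bar> * indicator (ball x r) y \<le> ennreal (2 * c ^ n * c) * shadow 1 f y"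
    proof (cases "y \<in> ball x r")
      case True
      have "bdist y \<le> dist y x" using bdist_le[OF xn] .
      have "ball y (bdist y / 2) \<subseteq> ball x (2 * r)"
      proof
        fix z assume "z \<in> ball y (bdist y / 2)"
        then have "dist y z < bdist y / 2" "bdist y \<le> dist x y" "dist x y < r"
          using True \<open>bdist y \<le> dist y x\<close> by (simp_all add: dist_commute)
        then have "dist x z < 2 * r"
          using dist_triangle[of x z y] zero_le_dist[of x y] by linarith
        then show "z \<in> ball x (2 * r)" by simp
      qed
      then have "avg (\<lambda>z. ennreal \<bar>u z - k\<bar>) y = avg f y"
        unfolding avg_def f_def by (intro arg_cong2[where f=divide] nn_integral_cong refl) (auto simp: indicator_def)
      then have "ennreal \<bar>smooth y - k\<bar> \<le> ennreal (2 * c ^ n) * avg f y"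
        using smooth_le_avg[OF y, of k] by simp
      also have "\<dots> \<le> ennreal (2 * c ^ n) * (ennreal c * shadow (2 * 0 + 1) f y)"
        using y by (intro mult_left_mono avg_le_shadow) auto
      finally show ?thesis using True c_pos by (simp add: ennreal_mult mult.assoc)
    qed simp
  qed
  also have "\<dots> = ennreal (2 * c ^ n * c) * (\<integral>\<^sup>+y. shadow 1 f y \<partial>N)"
    by (intro nn_integral_cmult measurable_shadow) measurable
  also have "\<dots> \<le> ennreal (2 * c ^ n * c) * (ennreal (c ^ 0) * (\<integral>\<^sup>+y. f y \<partial>N))"
    by (intro mult_left_mono nn_integral_shadow) auto
  finally show ?thesis by (simp add: f_def)
qed

text \<open>The factor \<open>bdist x\<close> from the Poincare inequality cancels the one in
  \<open>smooth_lipschitz\<close>, which leaves a Lipschitz bound whose constant does not depend on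
  the scale.\<close>

lemma smooth_poincare:
  assumes x: "x \<in> \<Omega>" and y: "y \<in> \<Omega>" and xy: "dist x y \<le> \<eta> * bdist x" and P: "0 \<le> P"
    and g: "(\<integral>\<^sup>+z. ennreal \<bar>u z - k\<bar> * indicator (ball x (3 * \<eta> * bdist x)) z \<partial>N) \<le>
      ennreal (P * bdist x) * (\<integral>\<^sup>+z. g z * indicator (ball x (bdist x / 2)) z \<partial>N)"
  shows "ennreal \<bar>smooth x - smooth y\<bar> \<le> ennreal (lip_const * P * dist x y) * avg g x"
proof -
  have d: "0 < bdist x" using bdist_pos x by auto
  have v: "0 < vol x (bdist x)" using vol_pos mem_closure x d by auto
  let ?D = "dev x (3 * \<eta> * bdist x) k"
  let ?G = "\<integral>\<^sup>+z. g z * indicator (ball x (bdist x / 2)) z \<partial>N"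
  have "\<bar>smooth x - smooth y\<bar> \<le> (lip_const * dist x y / (bdist x * vol x (bdist x))) * ?D"
    using smooth_lipschitz[OF x y xy, of k] d v by (simp add: field_simps)
  then have "ennreal \<bar>smooth x - smooth y\<bar> \<le> ennreal (lip_const * dist x y / (bdist x * vol x (bdist x))) * ennreal ?D"
    using lip_const_pos d v by (simp add: ennreal_mult'[symmetric] dev_nonneg ennreal_leI)
  also have "\<dots> \<le> ennreal (lip_const * dist x y / (bdist x * vol x (bdist x))) * (ennreal (P * bdist x) * ?G)"
    using g by (intro mult_left_mono) (auto simp: ennreal_dev mem_closure x)
  also have "\<dots> = ennreal (lip_const * P * dist x y * (1 / vol x (bdist x))) * ?G"
    using lip_const_pos d v P by (simp add: mult.assoc[symmetric] ennreal_mult[symmetric]) (simp add: mult_ac)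
  also have "\<dots> = ennreal (lip_const * P * dist x y) * (?G / ennreal (vol x (bdist x)))"
    using lip_const_pos v P by (subst ennreal_mult) (auto simp: divide_ennreal_def inverse_ennreal inverse_eq_divide mult_ac)
  finally show ?thesis by (simp add: avg_def)
qed

text \<open>On \<open>V\<close> the distance to the complement is bounded below by compactness, and
  the volumes of the balls by doubling. Then \<open>smooth_lipschitz\<close> with
  \<open>k = 0\<close> handles pairs at distance at most \<open>\<eta> * bdist x\<close>, and a
  uniform bound for \<open>smooth\<close> handles the others.\<close>

lemma smooth_lip_loc: "smooth \<in> lip_loc \<Omega>"
  unfolding lip_loc_def
proof (intro CollectI allI impI)
  fix V assume V: "open V \<and> compact (closure V) \<and> closure V \<subseteq> \<Omega>"
  show "\<exists>L. L-lipschitz_on V smooth"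
  proof (cases "V = {}")
    case True
    then show ?thesis by (intro exI[of _ 0]) (auto simp: lipschitz_on_def)
  next
    case False
    then obtain x0 where x0: "x0 \<in> V" by auto
    have VO: "V \<subseteq> \<Omega>" using V closure_subset by auto
    obtain \<epsilon> where \<epsilon>: "0 < \<epsilon>" "\<And>x. x \<in> V \<Longrightarrow> \<epsilon> \<le> bdist x"
    proof -
      obtain z where z: "z \<in> closure V" "\<And>x. x \<in> closure V \<Longrightarrow> bdist z \<le> bdist x"
        using continuous_attains_inf[of "closure V" bdist] V False continuous_bdist by auto
      then show ?thesis using that[of "bdist z"] V bdist_pos[of z] closure_subset[of V] by auto
    qed
    have "bounded V" using V compact_imp_bounded bounded_subset closure_subset by blast
    then obtain R' where "\<And>x. x \<in> V \<Longrightarrow> dist x0 x \<le> R'" using bounded_any_center[of V x0] by auto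
    then obtain R where R: "0 < R" "\<And>x. x \<in> V \<Longrightarrow> dist x0 x \<le> R"
      using max.cobounded1[of R' 1] by (metis less_max_iff_disj order_trans zero_less_one)
    \<comment> \<open>The number of doublings after which a ball of radius \<epsilon> around any
      point of \<open>V\<close> contains \<open>ball x0 1\<close>.\<close>
    obtain j where j: "(R + 1) / \<epsilon> < 2 ^ j" using real_arch_pow[of 2] by auto
    define m where "m = vol x0 1 / c ^ j"
    have m: "0 < m" using vol_pos mem_closure x0 VO c_pos by (auto simp: m_def)
    have mle: "m \<le> vol x (bdist x)" if x: "x \<in> V" for x
    proof -
      have "vol x0 1 \<le> c ^ j * vol x \<epsilon>"
        using x VO \<epsilon>(1) R(2)[OF x] j by (intro vol_compare mem_closure) (auto simp: field_simps dist_commute)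
      also have "\<dots> \<le> c ^ j * vol x (bdist x)"
        using \<epsilon>(2)[OF x] c_pos VO x by (intro mult_left_mono vol_mono mem_closure) auto
      finally show ?thesis using c_pos by (simp add: m_def field_simps)
    qed
    define U where "U = (\<integral>z. \<bar>u z\<bar> \<partial>N)"
    have U: "0 \<le> U" by (simp add: U_def)
    have dU: "dev x r 0 \<le> U" if "x \<in> V" for x r
      unfolding dev_def U_def using that VO
      by (intro Bochner_Integration.integral_mono integrable_dev integrable_abs u mem_closure) (auto simp: indicator_def)
    define B where "B = 2 * c ^ n * U / m"
    have B: "\<bar>smooth x\<bar> \<le> B" if x: "x \<in> V" for x
    proof -
      have "\<bar>smooth x\<bar> * m \<le> \<bar>smooth x\<bar> * vol x (bdist x)" using mle[OF x] by (intro mult_left_mono) auto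
      also have "\<dots> \<le> 2 * c ^ n * dev x (\<eta> * bdist x) 0" using smooth_dev[of x 0] x VO by auto
      also have "\<dots> \<le> 2 * c ^ n * U" using dU[OF x] c_pos by (intro mult_left_mono) auto
      finally show ?thesis using m by (simp add: B_def field_simps)
    qed
    define L where "L = max (lip_const * U / (\<epsilon> * m)) (2 * B / (\<eta> * \<epsilon>))"
    have "\<bar>smooth x - smooth y\<bar> \<le> L * dist x y" if xy: "x \<in> V" "y \<in> V" for x y
    proof (cases "dist x y \<le> \<eta> * bdist x")
      case True
      have "\<bar>smooth x - smooth y\<bar> * (\<epsilon> * m) \<le> \<bar>smooth x - smooth y\<bar> * (bdist x * vol x (bdist x))"
        using mle[OF xy(1)] \<epsilon>(2)[OF xy(1)] \<epsilon>(1) m by (intro mult_left_mono mult_mono) auto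
      also have "\<dots> \<le> lip_const * dist x y * dev x (3 * \<eta> * bdist x) 0"
        using xy VO True by (intro smooth_lipschitz) auto
      also have "\<dots> \<le> lip_const * dist x y * U" using lip_const_pos dU[OF xy(1)] by (intro mult_left_mono) auto
      finally have "\<bar>smooth x - smooth y\<bar> \<le> (lip_const * U / (\<epsilon> * m)) * dist x y"
        using \<epsilon>(1) m by (simp add: field_simps)
      also have "\<dots> \<le> L * dist x y" by (intro mult_right_mono) (auto simp: L_def)
      finally show ?thesis .
    next
      case False
      have B0: "0 \<le> B" using B[OF xy(1)] by linarith
      have "\<eta> * \<epsilon> \<le> dist x y" using False \<epsilon>(2)[OF xy(1)] \<eta> mult_left_mono[of \<epsilon> "bdist x" \<eta>] by linarith
      then have "2 * B * (\<eta> * \<epsilon>) \<le> 2 * B * dist x y" using B0 by (intro mult_left_mono) auto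
      then have "2 * B \<le> (2 * B / (\<eta> * \<epsilon>)) * dist x y" using \<eta> \<epsilon>(1) by (simp add: field_simps)
      also have "\<dots> \<le> L * dist x y" by (intro mult_right_mono) (auto simp: L_def)
      finally show ?thesis using B[OF xy(1)] B[OF xy(2)] by linarith
    qed
    moreover have "0 \<le> L" using lip_const_pos U \<epsilon>(1) m by (auto simp: L_def intro!: max.coboundedI1)
    ultimately show ?thesis by (intro exI[of _ L]) (auto simp: lipschitz_on_def dist_real_def)
  qed
qed

text \<open>This serves the measurability of \<open>smooth\<close>. It is taken from
  \<open>smooth_lipschitz\<close> directly, because membership in \<open>lip_loc\<close> speaks only
  of open sets with compact closure, and no such neighbourhoods are constructed here.\<close>

lemma continuous_on_smooth: "continuous_on \<Omega> smooth"
  unfolding continuous_on_iff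
proof (intro ballI allI impI)
  fix x e assume x: "x \<in> \<Omega>" and e: "0 < (e::real)"
  have d: "0 < bdist x" using bdist_pos x by auto
  have v: "0 < vol x (bdist x)" using vol_pos mem_closure x d by auto
  \<comment> \<open>Adding 1 keeps the constant positive when \<open>dev\<close> vanishes, so that
    \<open>e / L\<close> is meaningful.\<close>
  define L where "L = lip_const * dev x (3 * \<eta> * bdist x) 0 / (bdist x * vol x (bdist x)) + 1"
  have L: "0 < L" using lip_const_pos dev_nonneg d v by (auto simp: L_def intro!: add_nonneg_pos)
  show "\<exists>\<delta>>0. \<forall>y\<in>\<Omega>. dist y x < \<delta> \<longrightarrow> dist (smooth y) (smooth x) < e"
  proof (intro exI[of _ "min (\<eta> * bdist x) (e / L)"] conjI ballI impI)
    show "0 < min (\<eta> * bdist x) (e / L)" using \<eta> d L e by simp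
    fix y assume y: "y \<in> \<Omega>" "dist y x < min (\<eta> * bdist x) (e / L)"
    have "\<bar>smooth x - smooth y\<bar> * (bdist x * vol x (bdist x)) \<le> lip_const * dist x y * dev x (3 * \<eta> * bdist x) 0"
      using y by (intro smooth_lipschitz x) (auto simp: dist_commute)
    then have "\<bar>smooth x - smooth y\<bar> \<le> (L - 1) * dist x y" using d v by (simp add: L_def field_simps)
    also have "\<dots> \<le> L * dist x y" by (intro mult_right_mono) auto
    also have "\<dots> < e" using y L by (simp add: field_simps dist_commute)
    finally show "dist (smooth y) (smooth x) < e" by (simp add: dist_real_def abs_minus_commute)
  qed
qed

text \<open>The cone condition gives \<open>dist (\<gamma> 0) (\<gamma> t) \<le> t \<le> k * bdist
  (\<gamma> t)\<close>, so the averages of \<open>g\<close> at all points of the curve are bounded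
  by the single value of the shadow at \<open>\<gamma> 0\<close>. The local estimates then have a
  common constant and can be joined along the curve.\<close>

lemma curve_lipschitz:
  fixes \<gamma> :: "real \<Rightarrow> 'a"
  assumes \<gamma>: "\<And>s t. s \<in> {0..l} \<Longrightarrow> t \<in> {0..l} \<Longrightarrow> dist (\<gamma> s) (\<gamma> t) \<le> \<bar>s - t\<bar>"
    and l: "0 \<le> l" and \<gamma>\<Omega>: "\<gamma> ` {0..l} \<subseteq> \<Omega>"
    and cone: "\<And>t. t \<in> {0..l} \<Longrightarrow> t \<le> k * bdist (\<gamma> t)" and k: "0 \<le> k"
    and g [measurable]: "g \<in> borel_measurable N" and P: "0 < P"
    and loc: "\<And>x y. x \<in> \<Omega> \<Longrightarrow> y \<in> \<Omega> \<Longrightarrow> dist x y \<le> \<eta> * bdist x \<Longrightarrow>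
      ennreal \<bar>smooth x - smooth y\<bar> \<le> ennreal (P * dist x y) * avg g x"
  shows "ennreal \<bar>smooth (\<gamma> l) - smooth (\<gamma> 0)\<bar> \<le> ennreal (P * c * l) * shadow (2 * k + 1) g (\<gamma> 0)"
proof (cases "l = 0 \<or> shadow (2 * k + 1) g (\<gamma> 0) = \<infinity>")
  case True
  then show ?thesis using P c_pos l by (auto simp: ennreal_mult_top)
next
  case False
    define S where "S = enn2real (shadow (2 * k + 1) g (\<gamma> 0))"
    have S: "shadow (2 * k + 1) g (\<gamma> 0) = ennreal S" "0 \<le> S" using False by (auto simp: S_def less_top)
    have "\<bar>smooth (\<gamma> l) - smooth (\<gamma> 0)\<bar> \<le> (P * c * S) * (l - 0)"
    proof (rule locally_lipschitz_interval[OF l])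
      fix t assume t: "0 \<le> t" "t \<le> l"
      then have gt: "\<gamma> t \<in> \<Omega>" and g0: "\<gamma> 0 \<in> \<Omega>" using \<gamma>\<Omega> l by auto
      have "dist (\<gamma> 0) (\<gamma> t) \<le> k * bdist (\<gamma> t)"
        using \<gamma>[of 0 t] cone[of t] t by auto
      then have A: "avg g (\<gamma> t) \<le> ennreal (c * S)"
        using avg_le_shadow[OF g g0 gt _ k] S c_pos by (simp add: ennreal_mult)
      show "\<exists>d>0. \<forall>s. 0 \<le> s \<and> s \<le> l \<and> \<bar>s - t\<bar> < d \<longrightarrow> \<bar>smooth (\<gamma> s) - smooth (\<gamma> t)\<bar> \<le> P * c * S * \<bar>s - t\<bar>"
      proof (intro exI[of _ "\<eta> * bdist (\<gamma> t)"] conjI allI impI)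
        show "0 < \<eta> * bdist (\<gamma> t)" using \<eta> bdist_pos[OF gt] by simp
        fix s assume s: "0 \<le> s \<and> s \<le> l \<and> \<bar>s - t\<bar> < \<eta> * bdist (\<gamma> t)"
        have d: "dist (\<gamma> t) (\<gamma> s) \<le> \<bar>s - t\<bar>" using \<gamma>[of t s] s t by (auto simp: abs_minus_commute)
        have "ennreal \<bar>smooth (\<gamma> t) - smooth (\<gamma> s)\<bar> \<le> ennreal (P * dist (\<gamma> t) (\<gamma> s)) * avg g (\<gamma> t)"
          using s d \<gamma>\<Omega> by (intro loc gt) auto
        also have "\<dots> \<le> ennreal (P * \<bar>s - t\<bar>) * ennreal (c * S)"
          using A d P by (intro mult_mono ennreal_leI mult_left_mono) auto
        also have "\<dots> = ennreal (P * c * S * \<bar>s - t\<bar>)"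
          using P S c_pos by (simp add: ennreal_mult[symmetric] mult.commute mult.left_commute)
        finally show "\<bar>smooth (\<gamma> s) - smooth (\<gamma> t)\<bar> \<le> P * c * S * \<bar>s - t\<bar>"
          using P S c_pos by (simp add: abs_minus_commute)
      qed
    qed
    then show ?thesis
      using P S c_pos l by (simp add: ennreal_mult[symmetric] ennreal_leI mult.commute mult.left_commute)
qed

end

section \<open>The Poincare inequality inside the domain\<close>

lemma curve_integral_mono:
  "(\<And>x. f x \<le> g x) \<Longrightarrow> curve_integral a b \<gamma> f \<le> curve_integral a b \<gamma> g"
  unfolding curve_integral_def by (intro nn_integral_mono mult_right_mono) auto

lemma curve_integral_cmult_top:
  assumes "curve_integral a b \<gamma> f = \<infinity>" "0 < (e::real)"
  shows "curve_integral a b \<gamma> (\<lambda>x. ennreal e * f x) = \<infinity>"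
  using nn_integral_cmult_top[OF assms[unfolded curve_integral_def]]
  by (simp add: curve_integral_def mult.assoc)

lemma arc_length_parametrized_dist:
  assumes "arc_length_parametrized l \<gamma>" "s \<in> {0..l}" "t \<in> {0..l}"
  shows "dist (\<gamma> s) (\<gamma> t) \<le> \<bar>s - t\<bar>"
  using dist_le_curve_length_diff[of 0 l \<gamma> s t] assms by (auto simp: arc_length_parametrized_def)

text \<open>Where \<open>x\<close> is infinite, \<open>real_of_ereal\<close> is 0 but the right side
  is infinite; passing to real values can only decrease deviations.\<close>

lemma absdiff_real_of_ereal_le: "ennreal \<bar>real_of_ereal x - k\<bar> \<le> absdiff x (ereal k)"
  by (cases x) (auto simp: absdiff_ereal absdiff_infinite)

lemma abs_real_of_ereal_le: "ennreal \<bar>real_of_ereal x\<bar> \<le> e2ennreal \<bar>x\<bar>"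
  by (cases x) auto

locale caratheodory_measure =
  fixes mu :: "'a::metric_space set \<Rightarrow> ennreal" and M :: "'a measure"
  assumes regular: "borel_regular_outer_measure mu" and M: "M = induced_measure UNIV mu"
begin

lemma space_M: "space M = UNIV"
  and sets_M: "sets M = lambda_system UNIV (Pow UNIV) mu"
  and emeasure_M: "A \<in> sets M \<Longrightarrow> emeasure M A = mu A"
  using regular unfolding M borel_regular_outer_measure_def
  by (auto simp: space_induced_measure sets_induced_measure emeasure_induced_measure)

lemma borel_sets_M: "A \<in> sets borel \<Longrightarrow> A \<in> sets M"
  using regular by (auto simp: sets_M borel_regular_outer_measure_def)

lemma open_sets_M: "open A \<Longrightarrow> A \<in> sets M"
  by (simp add: borel_sets_M)

lemma borel_measurable_M: "f \<in> borel_measurable borel \<Longrightarrow> f \<in> borel_measurable M"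
  by (auto simp: measurable_def space_M intro: borel_sets_M)

text \<open>Regularity gives a Borel set of equal measure; finiteness turns equality of measures
  into a null difference.\<close>

lemma borel_hull:
  assumes "A \<in> sets M" "emeasure M A < \<infinity>"
  obtains B where "B \<in> sets borel" "A \<subseteq> B" "emeasure M (B - A) = 0"
proof -
  obtain B where B: "B \<in> sets borel" "A \<subseteq> B" "mu B = mu A"
    using regular unfolding borel_regular_outer_measure_def by blast
  then have "emeasure M (B - A) = emeasure M B - emeasure M A"
    using assms by (intro emeasure_Diff borel_sets_M[OF B(1)]) auto
  then have "emeasure M (B - A) = 0"
    using assms B by (simp add: emeasure_M borel_sets_M less_top)
  then show ?thesis using that B by blast
qed

text \<open>A weak upper gradient is only Caratheodory measurable, but an upper gradient must be
  Borel. Its superlevel sets at countably many dense levels are replaced by Borel hulls, and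
  \<open>h\<close> is rebuilt from them as a supremum: it dominates \<open>g\<close> everywhere, and
  exceeds it only on a countable union of null sets.\<close>

lemma borel_majorant:
  fixes g :: "'a \<Rightarrow> ennreal"
  assumes \<Omega>: "open \<Omega>" and sf: "sigma_finite_measure (restrict_space M \<Omega>)"
    and g: "g \<in> borel_measurable (restrict_space M \<Omega>)"
  obtains h where "h \<in> borel_measurable borel" "\<And>x. x \<in> \<Omega> \<Longrightarrow> g x \<le> h x"
    "AE x in restrict_space M \<Omega>. h x = g x"
proof -
  let ?N = "restrict_space M \<Omega>"
  have space_N: "space ?N = \<Omega>" by (simp add: space_restrict_space space_M)
  obtain F :: "nat \<Rightarrow> 'a set" where F: "range F \<subseteq> sets ?N" "(\<Union>i. F i) = \<Omega>" "\<And>i. emeasure ?N (F i) \<noteq> \<infinity>"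
    using sigma_finite_measure.sigma_finite[OF sf] unfolding space_N by metis
  obtain D :: "ennreal set" where D: "countable D" "\<And>X. open X \<Longrightarrow> X \<noteq> {} \<Longrightarrow> \<exists>d\<in>D. d \<in> X"
    using countable_dense_exists by metis
  \<comment> \<open>Superlevel sets may have infinite measure, so they are cut by the sets
    \<open>F i\<close> to make \<open>borel_hull\<close> applicable.\<close>
  define E where "E p = {x \<in> space ?N. x \<in> F (snd p) \<and> fst p < g x}" for p :: "ennreal \<times> nat"
  have EN: "E p \<in> sets ?N" for p
  proof -
    have "F (snd p) \<in> sets ?N" using F(1) by auto
    then have "F (snd p) \<inter> {x \<in> space ?N. fst p < g x} \<in> sets ?N"
      using g by (intro sets.Int borel_measurable_less) auto
    moreover have "F (snd p) \<inter> {x \<in> space ?N. fst p < g x} = E p" by (auto simp: E_def)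
    ultimately show ?thesis by simp
  qed
  have \<Omega>M: "\<Omega> \<inter> space M \<in> sets M" using \<Omega> by (simp add: space_M open_sets_M)
  have EM: "E p \<in> sets M" and EE: "emeasure M (E p) < \<infinity>" for p
  proof -
    show "E p \<in> sets M" using EN[of p] \<Omega>M by (auto simp: sets_restrict_space_iff)
    have "emeasure ?N (E p) \<le> emeasure ?N (F (snd p))" using F(1) by (intro emeasure_mono) (auto simp: E_def)
    also have "\<dots> < \<infinity>" using F(3) by (simp add: less_top)
    finally show "emeasure M (E p) < \<infinity>"
      using emeasure_restrict_space[OF \<Omega>M, of "E p"] by (auto simp: E_def space_N)
  qed
  have "\<exists>B. B \<in> sets borel \<and> E p \<subseteq> B \<and> emeasure M (B - E p) = 0" for p
    using borel_hull[OF EM EE] by metis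
  then obtain B where B: "\<And>p. B p \<in> sets borel" "\<And>p. E p \<subseteq> B p" "\<And>p. emeasure M (B p - E p) = 0"
    by metis
  define h where "h x = (SUP p\<in>D \<times> UNIV. fst p * indicator (B p) x)" for x
  have "h \<in> borel_measurable borel"
    unfolding h_def[abs_def] using D(1) B(1)
    by (intro borel_measurable_SUP borel_measurable_times borel_measurable_indicator) auto
  moreover have "g x \<le> h x" if x: "x \<in> \<Omega>" for x
  proof (rule dense_le)
    fix y assume "y < g x"
    then have "{y<..<g x} \<noteq> {}" using dense by auto
    then obtain d where d: "d \<in> D" "y < d" "d < g x" using D(2)[of "{y<..<g x}"] by auto
    obtain i where i: "x \<in> F i" using F(2) x by auto
    have "x \<in> B (d, i)" using B(2)[of "(d, i)"] d i x by (auto simp: E_def space_N)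
    then have "d \<le> h x"
      unfolding h_def using d(1) by (intro SUP_upper2[of "(d, i)"]) auto
    then show "y \<le> h x" using d(2) by simp
  qed
  moreover have "AE x in ?N. h x = g x"
  proof -
    have "AE x in M. x \<notin> B p - E p" for p
      using B(3) sets.Diff[OF borel_sets_M[OF B(1)] EM] by (intro AE_not_in) (auto simp: null_sets_def)
    then have "AE x in M. \<forall>p\<in>D \<times> UNIV. x \<notin> B p - E p"
      using D(1) by (subst AE_ball_countable) auto
    then have "AE x in ?N. \<forall>p\<in>D \<times> UNIV. x \<notin> B p - E p"
      by (subst AE_restrict_space_iff[OF \<Omega>M]) auto
    then show ?thesis
    proof (rule AE_mp, intro AE_I2 impI)
      fix x assume x: "x \<in> space ?N" and *: "\<forall>p\<in>D \<times> UNIV. x \<notin> B p - E p"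
      have "fst p * indicator (B p) x \<le> g x" if "p \<in> D \<times> UNIV" for p
      proof (cases "x \<in> B p")
        case True
        then have "x \<in> E p" using * that by auto
        then show ?thesis using True by (simp add: E_def less_imp_le)
      qed simp
      then have "h x \<le> g x" unfolding h_def by (intro SUP_least)
      then show "h x = g x" using \<open>\<And>x. x \<in> \<Omega> \<Longrightarrow> g x \<le> h x\<close>[of x] x by (simp add: space_N)
    qed
  qed
  ultimately show ?thesis by (rule that)
qed

lemma nn_integral_restrict_open:
  assumes "open A"
  shows "(\<integral>\<^sup>+x. f x \<partial>restrict_space M A) = (\<integral>\<^sup>+x. f x * indicator A x \<partial>M)"
  using assms by (intro nn_integral_restrict_space) (simp add: space_M open_sets_M)

lemma nn_integral_restrict_subset:
  assumes "open A" "open \<Omega>"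
  shows "(\<integral>\<^sup>+x. f x \<partial>restrict_space M (A \<inter> \<Omega>)) = (\<integral>\<^sup>+x. f x * indicator A x \<partial>restrict_space M \<Omega>)"
  using assms by (simp add: nn_integral_restrict_open open_Int indicator_inter_arith mult.assoc)

text \<open>Outside the ball of radius \<^term>\<open>lam * r\<close> the upper gradient is set to infinity: then no curve
  leaving the concentric ball of twice that radius matters, and no cut-off of \<^term>\<open>u\<close> is needed.\<close>

lemma local_poincare:
  fixes g :: "'a \<Rightarrow> ennreal"
  assumes \<Omega>: "open \<Omega>" and u: "u \<in> borel_measurable (restrict_space M \<Omega>)" "L1_norm M \<Omega> u < \<infinity>"
    and P: "\<forall>x. \<forall>r>0. \<forall>u\<in>L1_loc M. \<forall>g. upper_gradient u g \<longrightarrow>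
     mean_deviation M (ball x r) u (mean_value M (ball x r) u) \<le>
       ennreal (C * r) * ((\<integral>\<^sup>+y. g y \<partial>restrict_space M (ball x (lam * r))) / emeasure M (ball x (lam * r)))"
    and lam: "1 \<le> lam" and r: "0 < r" and ball: "ball x (2 * (lam * r)) \<subseteq> \<Omega>"
    and G: "G \<in> borel_measurable borel" "\<And>x. x \<in> \<Omega> \<Longrightarrow> g x \<le> G x"
    and \<Gamma>: "\<And>a b \<gamma>. (a, b, \<gamma>) \<in> \<Gamma> \<Longrightarrow> curve_integral a b \<gamma> G = \<infinity>"
    and ug: "\<And>a b \<gamma>. curve a b \<gamma> \<Longrightarrow> \<not> \<gamma> constant_on {a..b} \<Longrightarrow> \<gamma> ` {a..b} \<subseteq> \<Omega> \<Longrightarrow> (a, b, \<gamma>) \<notin> \<Gamma> \<Longrightarrow>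
           absdiff (u (\<gamma> a)) (u (\<gamma> b)) \<le> curve_integral a b \<gamma> g"
    and em: "0 < emeasure M (ball x r)" "emeasure M (ball x (lam * r)) < \<infinity>"
  shows "\<exists>k. (\<integral>\<^sup>+z. ennreal \<bar>real_of_ereal (u z) - k\<bar> * indicator (ball x r) z \<partial>restrict_space M \<Omega>) \<le>
    ennreal (C * r) * (\<integral>\<^sup>+z. G z * indicator (ball x (lam * r)) z \<partial>restrict_space M \<Omega>)"
proof -
  have "r \<le> lam * r" and lr: "0 < lam * r" using lam r by simp_all
  then have sub: "ball x r \<subseteq> ball x (lam * r)" "ball x (lam * r) \<subseteq> ball x (2 * (lam * r))" by auto
  \<comment> \<open>The extension by zero is integrable on the whole space. Its jump at the boundary
    of \<Omega> does no harm, because curves reaching the complement have infinite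
    \<open>H\<close>-integral.\<close>
  define w where "w z = (if z \<in> \<Omega> then u z else 0)" for z
  define H where "H z = (if z \<in> ball x (lam * r) then G z else \<infinity>)" for z
  have \<Omega>M: "\<Omega> \<inter> space M \<in> sets M" using \<Omega> by (simp add: space_M open_sets_M)
  have GH: "G z \<le> H z" for z by (simp add: H_def)
  have gH: "g z \<le> H z" for z
  proof (cases "z \<in> ball x (lam * r)")
    case True
    then have "z \<in> \<Omega>" using sub ball by blast
    then show ?thesis using G(2)[of z] True by (simp add: H_def)
  qed (simp add: H_def)
  have "upper_gradient w H"
    unfolding upper_gradient_def
  proof (intro conjI allI impI)
    show "H \<in> borel_measurable borel" unfolding H_def[abs_def] using G(1) by (intro measurable_If_set) auto
    fix a b and \<gamma> :: "real \<Rightarrow> 'a" assume \<gamma>: "curve a b \<gamma> \<and> \<not> \<gamma> constant_on {a..b}"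
    show "absdiff (w (\<gamma> a)) (w (\<gamma> b)) \<le> curve_integral a b \<gamma> H"
    proof (cases "\<gamma> ` {a..b} \<subseteq> ball x (2 * (lam * r))")
      case False
      then obtain q where "q \<in> {a..b}" "\<gamma> q \<notin> ball x (2 * (lam * r))" by blast
      then have "curve_integral a b \<gamma> H = \<infinity>"
        using \<gamma> lr by (intro curve_integral_leaving_ball) (auto simp: H_def)
      then show ?thesis by simp
    next
      case True
      then have \<gamma>\<Omega>: "\<gamma> ` {a..b} \<subseteq> \<Omega>" using ball by auto
      show ?thesis
      proof (cases "(a, b, \<gamma>) \<in> \<Gamma>")
        case True
        have "curve_integral a b \<gamma> H = \<infinity>"
          using curve_integral_mono[of G H a b \<gamma>] GH \<Gamma>[OF True] by (simp add: top.extremum_unique)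
        then show ?thesis by simp
      next
        case False
        have ab: "a \<le> b" using \<gamma> by (simp add: curve_def)
        have "absdiff (w (\<gamma> a)) (w (\<gamma> b)) = absdiff (u (\<gamma> a)) (u (\<gamma> b))"
          using \<gamma>\<Omega> ab by (auto simp: w_def image_subset_iff)
        also have "\<dots> \<le> curve_integral a b \<gamma> g" using \<gamma> \<gamma>\<Omega> False by (intro ug) auto
        also have "\<dots> \<le> curve_integral a b \<gamma> H" by (rule curve_integral_mono[OF gH])
        finally show ?thesis .
      qed
    qed
  qed
  moreover have "w \<in> L1_loc M"
    unfolding L1_loc_def L1_space_def
  proof (intro CollectI allI impI conjI)
    fix V :: "'a set" assume V: "open V \<and> compact (closure V)"
    have "w \<in> borel_measurable M"
      unfolding w_def[abs_def]
      using u(1) \<Omega>M by (subst measurable_If_restrict_space_iff) (auto simp: space_M)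
    then show "w \<in> borel_measurable (restrict_space M V)" by (rule measurable_restrict_space1)
    have "L1_norm M V w \<le> L1_norm M \<Omega> u"
      unfolding L1_norm_def using V \<Omega>
      by (auto simp: nn_integral_restrict_open w_def indicator_def zero_ereal_def intro!: nn_integral_mono)
    then show "L1_norm M V w < \<infinity>" using u(2) by simp
  qed
  ultimately have md: "mean_deviation M (ball x r) w (mean_value M (ball x r) w) \<le>
       ennreal (C * r) * ((\<integral>\<^sup>+y. H y \<partial>restrict_space M (ball x (lam * r))) / emeasure M (ball x (lam * r)))"
    using P r by blast
  define k where "k = mean_value M (ball x r) w"
  let ?L = "\<integral>\<^sup>+z. absdiff (w z) (ereal k) \<partial>restrict_space M (ball x r)"
  let ?R = "\<integral>\<^sup>+y. H y \<partial>restrict_space M (ball x (lam * r))"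
  have emr: "emeasure M (ball x r) \<le> emeasure M (ball x (lam * r))"
    using sub by (intro emeasure_mono) (auto simp: open_sets_M)
  have fin: "emeasure M (ball x r) < \<infinity>" using emr em(2) by (rule le_less_trans)
  \<comment> \<open>Passing from means to integrals: on the left the volume of the small ball is
    multiplied back, on the right the larger volume of the enlarged ball, which cancels the
    denominator there.\<close>
  have "?L = (?L / emeasure M (ball x r)) * emeasure M (ball x r)"
    using em(1) fin by (simp add: ennreal_divide_times ennreal_mult_divide_eq less_top)
  also have "\<dots> \<le> ennreal (C * r) * (?R / emeasure M (ball x (lam * r))) * emeasure M (ball x (lam * r))"
    using md emr unfolding mean_deviation_def k_def by (intro mult_mono) auto
  also have "\<dots> = ennreal (C * r) * ?R"
    using em emr by (simp add: mult.assoc ennreal_divide_times ennreal_mult_divide_eq less_top)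
  finally have LR: "?L \<le> ennreal (C * r) * ?R" .
  have "(\<integral>\<^sup>+z. ennreal \<bar>real_of_ereal (u z) - k\<bar> * indicator (ball x r) z \<partial>restrict_space M \<Omega>)
      \<le> (\<integral>\<^sup>+z. absdiff (w z) (ereal k) * indicator (ball x r) z \<partial>restrict_space M \<Omega>)"
    by (intro nn_integral_mono mult_right_mono)
       (auto simp: space_restrict_space w_def absdiff_real_of_ereal_le)
  also have "\<dots> = ?L"
    using sub ball by (subst nn_integral_restrict_subset[symmetric]) (auto simp: \<Omega> Int_absorb2)
  also have "\<dots> \<le> ennreal (C * r) * ?R" by (rule LR)
  also have "?R = (\<integral>\<^sup>+y. H y * indicator (ball x (lam * r)) y \<partial>restrict_space M \<Omega>)"
    using sub ball by (subst nn_integral_restrict_subset[symmetric]) (auto simp: \<Omega> Int_absorb2)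
  also have "\<dots> = (\<integral>\<^sup>+z. G z * indicator (ball x (lam * r)) z \<partial>restrict_space M \<Omega>)"
    by (intro nn_integral_cong) (auto simp: H_def indicator_def)
  finally show ?thesis by blast
qed

end

section \<open>Hajlasz gradients and boundary values\<close>

text \<open>Exposes the constant hidden in \<open>uniform_domain\<close>, since the aperture
  \<open>2 / a + 1\<close> and the norm bound depend on it.\<close>

definition uniform_with :: "real \<Rightarrow> 'a::metric_space set \<Rightarrow> bool" where
  "uniform_with a \<Omega> \<longleftrightarrow> (\<forall>x\<in>\<Omega>. \<forall>y\<in>\<Omega>. x \<noteq> y \<longrightarrow>
     (\<exists>l \<gamma>. arc_length_parametrized l \<gamma> \<and> \<gamma> ` {0..l} \<subseteq> \<Omega> \<and> \<gamma> 0 = x \<and> \<gamma> l = y \<and>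
              l \<le> dist x y / a \<and> (\<forall>t\<in>{0..l}. a * min t (l - t) \<le> infdist (\<gamma> t) (- \<Omega>))))"

context smoothing
begin

text \<open>All that is needed of an upper gradient: the Poincare inequality at the smoothing scale,
  with a constant \<open>k\<close> that may depend on \<open>x\<close>. Curves do not occur, so
  \<open>G\<close> may be a modified gradient.\<close>

definition controls :: "real \<Rightarrow> ('a \<Rightarrow> ennreal) \<Rightarrow> bool" where
  "controls P G \<longleftrightarrow> G \<in> borel_measurable N \<and> (\<forall>x\<in>\<Omega>. \<exists>k.
     (\<integral>\<^sup>+z. ennreal \<bar>u z - k\<bar> * indicator (ball x (3 * \<eta> * bdist x)) z \<partial>N) \<le>
       ennreal (P * bdist x) * (\<integral>\<^sup>+z. G z * indicator (ball x (bdist x / 2)) z \<partial>N))"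

lemma smooth_near:
  assumes G: "controls P G" and P: "0 < P" and x: "x \<in> \<Omega>" and y: "y \<in> \<Omega>" and xy: "dist x y \<le> \<eta> * bdist x"
  shows "ennreal \<bar>smooth x - smooth y\<bar> \<le> ennreal (lip_const * P * dist x y) * avg G x"
proof -
  obtain k where "(\<integral>\<^sup>+z. ennreal \<bar>u z - k\<bar> * indicator (ball x (3 * \<eta> * bdist x)) z \<partial>N) \<le>
       ennreal (P * bdist x) * (\<integral>\<^sup>+z. G z * indicator (ball x (bdist x / 2)) z \<partial>N)"
    using G x by (auto simp: controls_def)
  then show ?thesis using P by (intro smooth_poincare x y xy) auto
qed

text \<open>For near pairs the average is compared with the shadow at the same point, that is with
  \<open>k = 0\<close>, so the aperture is 1. The term at \<open>y\<close> is added only to reach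
  the symmetric form of a Hajlasz inequality.\<close>

lemma smooth_near_shadow:
  assumes G: "controls P G" and P: "0 < P" and x: "x \<in> \<Omega>" and y: "y \<in> \<Omega>" and xy: "near \<eta> \<Omega> x y"
  shows "ennreal \<bar>smooth x - smooth y\<bar> \<le>
    ennreal (dist x y) * (ennreal (lip_const * P * c) * shadow 1 G x + ennreal (lip_const * P * c) * shadow 1 G y)"
proof -
  have "dist x y \<le> \<eta> * bdist x"
    using xy \<eta> mult_left_mono[OF min.cobounded1, of \<eta> "infdist x (- \<Omega>)" "infdist y (- \<Omega>)"]
    unfolding near_def bdist_def by linarith
  then have "ennreal \<bar>smooth x - smooth y\<bar> \<le> ennreal (lip_const * P * dist x y) * avg G x"
    by (rule smooth_near[OF G P x y])
  also have "\<dots> \<le> ennreal (lip_const * P * dist x y) * (ennreal c * shadow (2 * 0 + 1) G x)"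
    using G x by (intro mult_left_mono avg_le_shadow) (auto simp: controls_def)
  also have "\<dots> = ennreal (dist x y) * (ennreal (lip_const * P * c) * shadow 1 G x)"
    using lip_const_pos P c_pos by (simp add: mult.assoc[symmetric] ennreal_mult[symmetric]) (simp add: mult_ac)
  also have "\<dots> \<le> ennreal (dist x y) * (ennreal (lip_const * P * c) * shadow 1 G x + ennreal (lip_const * P * c) * shadow 1 G y)"
    by (intro mult_left_mono) auto
  finally show ?thesis .
qed

text \<open>The curve is cut at its midpoint. Up to there the uniformity condition reads
  \<open>t \<le> bdist (\<gamma> t) / a\<close>, the cone condition of
  \<open>curve_lipschitz\<close> with \<open>k = 1 / a\<close>; the other half is traversed
  backwards from \<open>y\<close>. The two shadows, at \<open>x\<close> and at \<open>y\<close>, are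
  the two terms of the Hajlasz inequality.\<close>

lemma smooth_uniform_shadow:
  assumes G: "controls P G" and P: "0 < P" and x: "x \<in> \<Omega>" and y: "y \<in> \<Omega>"
    and a: "0 < a" and uniform: "uniform_with a \<Omega>"
  shows "ennreal \<bar>smooth x - smooth y\<bar> \<le> ennreal (dist x y) *
    (ennreal (lip_const * P * c / a) * shadow (2 / a + 1) G x + ennreal (lip_const * P * c / a) * shadow (2 / a + 1) G y)"
proof (cases "x = y")
  case False
  then obtain l \<gamma> where \<gamma>: "arc_length_parametrized l \<gamma>" "\<gamma> ` {0..l} \<subseteq> \<Omega>" "\<gamma> 0 = x" "\<gamma> l = y"
      "l \<le> dist x y / a" "\<And>t. t \<in> {0..l} \<Longrightarrow> a * min t (l - t) \<le> bdist (\<gamma> t)"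
    using uniform[unfolded uniform_with_def, rule_format, OF x y] by (auto simp: bdist_def)
  have l: "0 \<le> l" using \<gamma>(1) by (simp add: arc_length_parametrized_def curve_def)
  note lip = arc_length_parametrized_dist[OF \<gamma>(1)]
  have Gm: "G \<in> borel_measurable N" using G by (simp add: controls_def)
  have half: "ennreal (lip_const * P * c * (l / 2)) * S \<le> ennreal (dist x y) * (ennreal (lip_const * P * c / a) * S)" for S
  proof -
    have "l / 2 \<le> dist x y / a" using \<gamma>(5) l by linarith
    then have "lip_const * P * c * (l / 2) \<le> lip_const * P * c * (dist x y / a)"
      using lip_const_pos P c_pos by (intro mult_left_mono) auto
    then have "ennreal (lip_const * P * c * (l / 2)) * S \<le> ennreal (dist x y * (lip_const * P * c / a)) * S"
      by (intro mult_right_mono ennreal_leI) (auto simp: mult_ac)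
    also have "\<dots> = ennreal (dist x y) * (ennreal (lip_const * P * c / a) * S)"
      using lip_const_pos P c_pos a by (subst ennreal_mult) (auto simp: mult.assoc)
    finally show ?thesis .
  qed
  have cone: "t \<le> (1 / a) * bdist (\<gamma> t)" if "t \<in> {0..l / 2}" for t
    using \<gamma>(6)[of t] that a by (auto simp: min_def field_simps split: if_splits)
  have cone': "t \<le> (1 / a) * bdist (\<gamma> (l - t))" if "t \<in> {0..l / 2}" for t
    using \<gamma>(6)[of "l - t"] that a by (auto simp: min_def field_simps split: if_splits)
  have "ennreal \<bar>smooth (\<gamma> (l / 2)) - smooth (\<gamma> 0)\<bar> \<le> ennreal (lip_const * P * c * (l / 2)) * shadow (2 * (1 / a) + 1) G (\<gamma> 0)"
    using \<gamma>(2) l a lip_const_pos P smooth_near[OF G P]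
    by (intro curve_lipschitz lip cone Gm) (auto simp: image_subset_iff)
  then have 1: "ennreal \<bar>smooth (\<gamma> (l / 2)) - smooth x\<bar> \<le> ennreal (dist x y) * (ennreal (lip_const * P * c / a) * shadow (2 / a + 1) G x)"
    using half \<gamma>(3) by (auto intro: order_trans)
  \<comment> \<open>The arguments \<open>l - l / 2\<close> and \<open>l - 0\<close> are left
    unsimplified to match the reversed curve.\<close>
  have "ennreal \<bar>smooth (\<gamma> (l - l / 2)) - smooth (\<gamma> (l - 0))\<bar> \<le> ennreal (lip_const * P * c * (l / 2)) * shadow (2 * (1 / a) + 1) G (\<gamma> (l - 0))"
  proof (rule curve_lipschitz[where \<gamma>="\<lambda>t. \<gamma> (l - t)"])
    show "dist (\<gamma> (l - s)) (\<gamma> (l - t)) \<le> \<bar>s - t\<bar>" if "s \<in> {0..l / 2}" "t \<in> {0..l / 2}" for s t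
      using lip[of "l - s" "l - t"] that by (auto simp: abs_minus_commute)
  qed (use \<gamma>(2) l a lip_const_pos P smooth_near[OF G P] cone' Gm in \<open>auto simp: image_subset_iff\<close>)
  then have 2: "ennreal \<bar>smooth (\<gamma> (l / 2)) - smooth y\<bar> \<le> ennreal (dist x y) * (ennreal (lip_const * P * c / a) * shadow (2 / a + 1) G y)"
    using half \<gamma>(4) by (auto intro: order_trans)
  have "ennreal \<bar>smooth x - smooth y\<bar> \<le> ennreal (\<bar>smooth (\<gamma> (l / 2)) - smooth x\<bar> + \<bar>smooth (\<gamma> (l / 2)) - smooth y\<bar>)"
    by (intro ennreal_leI) auto
  also have "\<dots> = ennreal \<bar>smooth (\<gamma> (l / 2)) - smooth x\<bar> + ennreal \<bar>smooth (\<gamma> (l / 2)) - smooth y\<bar>" by simp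
  also have "\<dots> \<le> ennreal (dist x y) * (ennreal (lip_const * P * c / a) * shadow (2 / a + 1) G x) +
      ennreal (dist x y) * (ennreal (lip_const * P * c / a) * shadow (2 / a + 1) G y)"
    by (rule add_mono[OF 1 2])
  finally show ?thesis by (simp add: distrib_left)
qed simp

lemma smooth_measurable: "smooth \<in> borel_measurable N"
proof -
  have "smooth \<in> borel_measurable (restrict_space borel \<Omega>)"
    by (rule borel_measurable_continuous_on_restrict[OF continuous_on_smooth])
  moreover have "(\<lambda>x. x) \<in> measurable N (restrict_space borel \<Omega>)"
    by (intro measurable_restrict_space2) (auto simp: space_N)
  ultimately show ?thesis using measurable_compose by blast
qed

text \<open>Treats the local and the global space at once: they differ in the relation
  \<open>Q\<close>, the aperture \<open>K\<close> and the constant \<open>D\<close>.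
  \<open>I\<close> will be the infimum of the gradient norms, which need not be attained, so the
  norm bound is proved up to an arbitrary error.\<close>

lemma smooth_hajlasz:
  assumes N: "N = restrict_space M \<Omega>"
    and I: "\<And>e::real. 0 < e \<Longrightarrow> \<exists>G. controls P G \<and> (\<integral>\<^sup>+x. G x \<partial>N) \<le> I + ennreal e" "I < \<infinity>"
    and K: "K \<le> 2 ^ j" and D: "0 < D"
    and Q: "\<And>G x y. controls P G \<Longrightarrow> x \<in> \<Omega> \<Longrightarrow> y \<in> \<Omega> \<Longrightarrow> Q x y \<Longrightarrow>
      ennreal \<bar>smooth x - smooth y\<bar> \<le> ennreal (dist x y) * (ennreal D * shadow K G x + ennreal D * shadow K G y)"
  shows "(\<lambda>x. ereal (smooth x)) \<in> hajlasz_space_wrt M \<Omega> Q"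
    and "hajlasz_norm_wrt M \<Omega> Q (\<lambda>x. ereal (smooth x)) \<le>
      ennreal (2 * c ^ n * c + D * c ^ j) * ((\<integral>\<^sup>+x. ennreal \<bar>u x\<bar> \<partial>N) + I)"
proof -
  have g: "(\<lambda>x. ennreal D * shadow K G x) \<in> hajlasz_gradients M \<Omega> Q (\<lambda>x. ereal (smooth x))"
      "(\<integral>\<^sup>+x. ennreal D * shadow K G x \<partial>N) \<le> ennreal (D * c ^ j) * (\<integral>\<^sup>+x. G x \<partial>N)"
    if G: "controls P G" "(\<integral>\<^sup>+x. G x \<partial>N) < \<infinity>" for G
  proof -
    have [measurable]: "G \<in> borel_measurable N" "shadow K G \<in> borel_measurable N"
      using G(1) measurable_shadow by (auto simp: controls_def)
    have "(\<integral>\<^sup>+x. ennreal D * shadow K G x \<partial>N) = ennreal D * (\<integral>\<^sup>+x. shadow K G x \<partial>N)"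
      by (intro nn_integral_cmult) measurable
    also have "\<dots> \<le> ennreal D * (ennreal (c ^ j) * (\<integral>\<^sup>+x. G x \<partial>N))"
      by (intro mult_left_mono nn_integral_shadow K) auto
    also have "\<dots> = ennreal (D * c ^ j) * (\<integral>\<^sup>+x. G x \<partial>N)"
      using D c_pos by (simp add: ennreal_mult mult.assoc)
    finally show int: "(\<integral>\<^sup>+x. ennreal D * shadow K G x \<partial>N) \<le> ennreal (D * c ^ j) * (\<integral>\<^sup>+x. G x \<partial>N)" .
    also have "\<dots> < \<infinity>" using G(2) by (simp add: ennreal_mult_less_top)
    finally have "(\<integral>\<^sup>+x. ennreal D * shadow K G x \<partial>N) < \<infinity>" .
    \<comment> \<open>The estimate holds at all points of \<Omega>, so the exceptional null set can
      be empty.\<close>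
    then show "(\<lambda>x. ennreal D * shadow K G x) \<in> hajlasz_gradients M \<Omega> Q (\<lambda>x. ereal (smooth x))"
      unfolding hajlasz_gradients_def N[symmetric]
      using Q[OF G(1)] by (auto simp: absdiff_ereal intro!: bexI[of _ "{}"])
  qed
  have L1: "L1_norm M \<Omega> (\<lambda>x. ereal (smooth x)) \<le> ennreal (2 * c ^ n * c) * (\<integral>\<^sup>+x. ennreal \<bar>u x\<bar> \<partial>N)"
    unfolding L1_norm_def N[symmetric] using nn_integral_smooth by simp
  have uf: "(\<integral>\<^sup>+x. ennreal \<bar>u x\<bar> \<partial>N) < \<infinity>"
    using u by (simp add: integrable_iff_bounded)
  have fin: "\<exists>G. controls P G \<and> (\<integral>\<^sup>+x. G x \<partial>N) \<le> I + ennreal e \<and> (\<integral>\<^sup>+x. G x \<partial>N) < \<infinity>" if "0 < e" for e :: real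
    using I(1)[OF that] I(2) by (metis ennreal_add_eq_top ennreal_neq_top infinity_ennreal_def le_less_trans less_top)
  have "L1_norm M \<Omega> (\<lambda>x. ereal (smooth x)) < \<infinity>"
    using L1 uf by (auto intro: le_less_trans simp: ennreal_mult_less_top)
  moreover have "(\<lambda>x. ereal (smooth x)) \<in> borel_measurable (restrict_space M \<Omega>)"
    using smooth_measurable unfolding N by simp
  moreover have "hajlasz_gradients M \<Omega> Q (\<lambda>x. ereal (smooth x)) \<noteq> {}"
    using fin[OF zero_less_one] g(1) by blast
  ultimately show "(\<lambda>x. ereal (smooth x)) \<in> hajlasz_space_wrt M \<Omega> Q"
    by (simp add: hajlasz_space_wrt_def L1_space_def)
  let ?A = "\<integral>\<^sup>+x. ennreal \<bar>u x\<bar> \<partial>N" and ?C = "2 * c ^ n * c + D * c ^ j"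
  show "hajlasz_norm_wrt M \<Omega> Q (\<lambda>x. ereal (smooth x)) \<le> ennreal ?C * (?A + I)"
  proof (rule ennreal_le_epsilon)
    fix e :: real assume "0 < e"
    define e' where "e' = e / ?C"
    have C: "0 < ?C" using c_pos D by (intro add_pos_pos mult_pos_pos) auto
    then have "0 < e'" using \<open>0 < e\<close> by (simp add: e'_def)
    then obtain G where G: "controls P G" "(\<integral>\<^sup>+x. G x \<partial>N) \<le> I + ennreal e'" "(\<integral>\<^sup>+x. G x \<partial>N) < \<infinity>"
      using fin by blast
    have "hajlasz_norm_wrt M \<Omega> Q (\<lambda>x. ereal (smooth x)) \<le>
        ennreal (2 * c ^ n * c) * ?A + (\<integral>\<^sup>+x. ennreal D * shadow K G x \<partial>N)"
      unfolding hajlasz_norm_wrt_def N[symmetric]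
      by (intro add_mono L1 INF_lower g G)
    also have "\<dots> \<le> ennreal (2 * c ^ n * c) * ?A + ennreal (D * c ^ j) * (I + ennreal e')"
      using order_trans[OF g(2)[OF G(1,3)] mult_left_mono[OF G(2), of "ennreal (D * c ^ j)"]]
      by (intro add_left_mono) auto
    also have "\<dots> \<le> ennreal ?C * ?A + ennreal ?C * (I + ennreal e')"
      using c_pos D by (intro add_mono mult_right_mono ennreal_leI) auto
    also have "\<dots> = ennreal ?C * (?A + I) + ennreal e"
      using C \<open>0 < e'\<close> by (simp add: distrib_left add.assoc e'_def ennreal_mult[symmetric])
    finally show "hajlasz_norm_wrt M \<Omega> Q (\<lambda>x. ereal (smooth x)) \<le> ennreal ?C * (?A + I) + ennreal e" .
  qed
qed

text \<open>The deviation over radius \<open>r\<close> is at most a constant times that of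
  \<open>w\<close> over radius \<open>2 * r\<close>; the extra factor \<open>c\<close> in the
  constant comes from doubling at the boundary point \<open>x\<close> itself.\<close>

lemma smooth_boundary_value:
  fixes w :: "'a \<Rightarrow> ereal"
  assumes M: "\<And>f A. open A \<Longrightarrow> (\<integral>\<^sup>+x. f x \<partial>restrict_space M (A \<inter> \<Omega>)) = (\<integral>\<^sup>+x. f x * indicator A x \<partial>N)"
    and em: "\<And>A. open A \<Longrightarrow> emeasure M (A \<inter> \<Omega>) = emeasure N (A \<inter> \<Omega>)"
    and w: "\<And>z. u z = real_of_ereal (w z)"
    and x: "x \<in> frontier \<Omega>" and bv: "has_boundary_value M \<Omega> w x k"
  shows "has_boundary_value M \<Omega> (\<lambda>x. ereal (smooth x)) x k"
proof -
  have xc: "x \<in> closure \<Omega>" using x by (simp add: frontier_def)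
  let ?C = "2 * c ^ n * c"
  have le: "mean_deviation M (ball x r \<inter> \<Omega>) (\<lambda>x. ereal (smooth x)) k \<le>
      ennreal (?C * c) * mean_deviation M (ball x (2 * r) \<inter> \<Omega>) w k" if r: "0 < r" for r
  proof -
    have v: "0 < vol x r" "0 < vol x (2 * r)" using vol_pos[OF xc] r by auto
    let ?U = "\<integral>\<^sup>+y. absdiff (w y) (ereal k) * indicator (ball x (2 * r)) y \<partial>N"
    have "(\<integral>\<^sup>+y. ennreal \<bar>smooth y - k\<bar> * indicator (ball x r) y \<partial>N) \<le>
        ennreal ?C * (\<integral>\<^sup>+y. ennreal \<bar>u y - k\<bar> * indicator (ball x (2 * r)) y \<partial>N)"
      by (rule nn_integral_smooth_boundary[OF x])
    also have "\<dots> \<le> ennreal ?C * ?U"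
      unfolding w by (intro mult_left_mono nn_integral_mono mult_right_mono absdiff_real_of_ereal_le) auto
    finally have "mean_deviation M (ball x r \<inter> \<Omega>) (\<lambda>x. ereal (smooth x)) k \<le> ennreal ?C * ?U / ennreal (vol x r)"
      unfolding mean_deviation_def by (auto simp: M em emeasure_ball xc absdiff_ereal intro!: divide_right_mono_ennreal)
    also have "\<dots> = (ennreal ?C * ennreal (1 / vol x r)) * ?U"
      using v by (simp add: divide_ennreal_def inverse_ennreal inverse_eq_divide mult_ac)
    also have "\<dots> \<le> (ennreal ?C * ennreal (c * (1 / vol x (2 * r)))) * ?U"
      using vol_double[OF xc r] v by (intro mult_right_mono mult_left_mono ennreal_leI) (auto simp: field_simps)
    also have "\<dots> = ennreal (?C * c) * (?U * ennreal (1 / vol x (2 * r)))"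
    proof -
      have "ennreal ?C * ennreal (c * (1 / vol x (2 * r))) = ennreal (?C * c * (1 / vol x (2 * r)))"
        using v c_pos by (subst ennreal_mult[symmetric]) (auto simp: mult.assoc)
      also have "\<dots> = ennreal (?C * c) * ennreal (1 / vol x (2 * r))"
        using v c_pos by (intro ennreal_mult) auto
      finally show ?thesis by (simp only: mult.assoc mult.commute[of "ennreal (1 / vol x (2 * r))"])
    qed
    also have "\<dots> = ennreal (?C * c) * mean_deviation M (ball x (2 * r) \<inter> \<Omega>) w k"
      unfolding mean_deviation_def using v
      by (simp add: M em emeasure_ball xc divide_ennreal_def inverse_ennreal inverse_eq_divide)
    finally show ?thesis .
  qed
  have "filterlim (\<lambda>r::real. 2 * r) (at_right 0) (at_right 0)"
    by (intro tendsto_imp_filterlim_at_right) (auto intro!: tendsto_eq_intros simp: eventually_at_filter)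
  then have "((\<lambda>r. mean_deviation M (ball x (2 * r) \<inter> \<Omega>) w k) \<longlongrightarrow> 0) (at_right 0)"
    using filterlim_compose[OF bv[unfolded has_boundary_value_def]] by blast
  from ennreal_tendsto_cmult[OF _ this, of "ennreal (?C * c)"]
  have lim: "((\<lambda>r. ennreal (?C * c) * mean_deviation M (ball x (2 * r) \<inter> \<Omega>) w k) \<longlongrightarrow> 0) (at_right 0)"
    by simp
  show ?thesis
    unfolding has_boundary_value_def
  proof (rule tendsto_sandwich[OF _ _ tendsto_const lim])
    show "\<forall>\<^sub>F r in at_right 0. mean_deviation M (ball x r \<inter> \<Omega>) (\<lambda>x. ereal (smooth x)) k \<le>
        ennreal (?C * c) * mean_deviation M (ball x (2 * r) \<inter> \<Omega>) w k"
      using eventually_at_right_less[of "0::real"] by eventually_elim (rule le)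
  qed auto
qed

end

section \<open>From Newtonian functions to Hajlasz functions, and the theorem\<close>

locale poincare_domain = caratheodory_measure mu M + doubling_domain "restrict_space M \<Omega>" \<Omega> c
  for mu and M :: "'a::metric_space measure" and \<Omega> c +
  fixes C lam :: real
  assumes C: "0 < C" and lam: "1 \<le> lam"
    and poincare: "\<forall>x. \<forall>r>0. \<forall>u\<in>L1_loc M. \<forall>g. upper_gradient u g \<longrightarrow>
     mean_deviation M (ball x r) u (mean_value M (ball x r) u) \<le>
       ennreal (C * r) * ((\<integral>\<^sup>+y. g y \<partial>restrict_space M (ball x (lam * r))) / emeasure M (ball x (lam * r)))"
begin

lemma emeasure_restrict_domain: "A \<subseteq> \<Omega> \<Longrightarrow> emeasure (restrict_space M \<Omega>) A = emeasure M A"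
  by (rule emeasure_restrict_space) (simp_all add: space_M open_sets_M open_domain)

text \<open>One \<open>v\<close> has all the properties, and \<open>\<eta>\<close>,
  \<open>n\<close>, \<open>D\<close> are given before \<open>u\<close>, which makes the constants
  independent of \<open>u\<close>. \<open>D\<close> is the Lipschitz constant of the smoothing times
  the Poincare factor \<open>C * (3 * \<eta>)\<close> times the doubling step from averages to
  shadows.\<close>

lemma smooth_approximation:
  fixes u :: "'a \<Rightarrow> ereal"
  assumes u: "u \<in> newton_space M \<Omega>" and eta: "\<eta> = 1 / (6 * lam)" and n: "2 \<le> 2 ^ n * \<eta>"
    and D: "D = 4 * c ^ n * (1 + 2 * c ^ n * c) / \<eta> * (C * (3 * \<eta>)) * c"
  obtains v where "v \<in> lip_loc \<Omega>"
    "\<And>x k. x \<in> frontier \<Omega> \<Longrightarrow> has_boundary_value M \<Omega> u x k \<Longrightarrow> has_boundary_value M \<Omega> (\<lambda>x. ereal (v x)) x k"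
    "(\<lambda>x. ereal (v x)) \<in> M11_loc_space M \<Omega> \<eta>"
    "M11_loc_norm M \<Omega> \<eta> (\<lambda>x. ereal (v x)) \<le> ennreal (2 * c ^ n * c + D) * newton_norm M \<Omega> u"
    "\<And>a j. 0 < a \<Longrightarrow> 2 / a + 1 \<le> 2 ^ j \<Longrightarrow>
      uniform_with a \<Omega> \<Longrightarrow>
      (\<lambda>x. ereal (v x)) \<in> M11_space M \<Omega> \<and>
      M11_norm M \<Omega> (\<lambda>x. ereal (v x)) \<le> ennreal (2 * c ^ n * c + D / a * c ^ j) * newton_norm M \<Omega> u"
proof -
  let ?N = "restrict_space M \<Omega>"
  define I where "I = (INF g\<in>{g. weak_upper_gradient M \<Omega> u g}. \<integral>\<^sup>+x. g x \<partial>?N)"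
  have newton: "newton_norm M \<Omega> u = L1_norm M \<Omega> u + I" by (simp add: newton_norm_def I_def)
  then have fin: "L1_norm M \<Omega> u < \<infinity>" "I < \<infinity>" and um: "u \<in> borel_measurable ?N"
    using u by (auto simp: newton_space_def)
  have \<eta>': "0 < \<eta>" "\<eta> \<le> 1 / 6" using lam by (auto simp: eta field_simps)
  have real_le: "(\<integral>\<^sup>+x. ennreal \<bar>real_of_ereal (u x)\<bar> \<partial>?N) \<le> L1_norm M \<Omega> u"
    unfolding L1_norm_def by (intro nn_integral_mono abs_real_of_ereal_le)
  have "integrable ?N (\<lambda>x. real_of_ereal (u x))"
    using um le_less_trans[OF real_le fin(1)] by (simp add: integrable_iff_bounded)
  then interpret smoothing ?N \<Omega> c "\<lambda>x. real_of_ereal (u x)" \<eta> n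
    using \<eta>' n by unfold_locales auto
  define P where "P = C * (3 * \<eta>)"
  have P: "0 < P" using C \<eta>' by (simp add: P_def)
  have DP: "D = lip_const * P * c" by (simp add: D P_def lip_const_def)
  have D0: "0 < D" using lip_const_pos P c_pos by (simp add: DP)
  have controls: "\<exists>G. controls P G \<and> (\<integral>\<^sup>+x. G x \<partial>?N) \<le> I + ennreal e" if e: "0 < e" for e :: real
  proof -
    \<comment> \<open>Strict because \<open>I\<close> is finite. Half of \<open>e\<close> is spent
      on choosing \<open>g\<close>, the other half on the exceptional curves.\<close>
    have "I < I + ennreal (e / 2)" using fin(2) e by (cases I) (auto simp: ennreal_less_iff simp flip: ennreal_plus)
    then obtain g where g: "weak_upper_gradient M \<Omega> u g" "(\<integral>\<^sup>+x. g x \<partial>?N) < I + ennreal (e / 2)"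
      unfolding I_def INF_less_iff by auto
    have gm: "g \<in> borel_measurable ?N" using g(1) by (simp add: weak_upper_gradient_def)
    obtain \<Gamma> where \<Gamma>: "zero_modulus M \<Gamma>"
      and ug': "\<forall>a b \<gamma>. curve a b \<gamma> \<and> \<not> \<gamma> constant_on {a..b} \<and> \<gamma> ` {a..b} \<subseteq> \<Omega> \<and> (a, b, \<gamma>) \<notin> \<Gamma> \<longrightarrow>
           absdiff (u (\<gamma> a)) (u (\<gamma> b)) \<le> curve_integral a b \<gamma> g"
      using g(1) unfolding weak_upper_gradient_def by (elim conjE exE) (rule that)
    have ug: "absdiff (u (\<gamma> a)) (u (\<gamma> b)) \<le> curve_integral a b \<gamma> g"
      if "curve a b \<gamma>" "\<not> \<gamma> constant_on {a..b}" "\<gamma> ` {a..b} \<subseteq> \<Omega>" "(a, b, \<gamma>) \<notin> \<Gamma>" for a b \<gamma>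
      using ug' that by blast
    obtain \<rho> where \<rho>: "\<rho> \<in> borel_measurable borel" "(\<integral>\<^sup>+x. \<rho> x \<partial>M) < \<infinity>"
        and \<rho>': "\<forall>(a, b, \<gamma>)\<in>\<Gamma>. curve_integral a b \<gamma> \<rho> = \<infinity>"
      using \<Gamma> unfolding zero_modulus_def by (elim conjE exE) (rule that)
    obtain h where h: "h \<in> borel_measurable borel" "\<And>x. x \<in> \<Omega> \<Longrightarrow> g x \<le> h x" "AE x in ?N. h x = g x"
      using borel_majorant[OF open_domain sigma_finite gm] by blast
    define R where "R = enn2real (\<integral>\<^sup>+x. \<rho> x \<partial>M)"
    have R: "(\<integral>\<^sup>+x. \<rho> x \<partial>M) = ennreal R" "0 \<le> R" using \<rho>(2) by (auto simp: R_def)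
    \<comment> \<open>The added 1 covers the case \<open>R = 0\<close>.\<close>
    define \<epsilon> where "\<epsilon> = e / 2 / (R + 1)"
    have \<epsilon>: "0 < \<epsilon>" "\<epsilon> * R \<le> e / 2" using e R(2) by (auto simp: \<epsilon>_def field_simps)
    \<comment> \<open>Borel, at least \<open>g\<close> on \<Omega>, and with infinite integral along
      every curve of \<Gamma>: the three properties that \<open>local_poincare\<close> asks
      for.\<close>
    define G where "G x = h x + ennreal \<epsilon> * \<rho> x" for x
    have G: "G \<in> borel_measurable borel" unfolding G_def[abs_def] using h(1) \<rho>(1) by measurable
    have meas: "f \<in> borel_measurable borel \<Longrightarrow> f \<in> borel_measurable ?N" for f :: "'a \<Rightarrow> ennreal"
      by (intro measurable_restrict_space1 borel_measurable_M)
    have "(\<integral>\<^sup>+x. G x \<partial>?N) = (\<integral>\<^sup>+x. h x \<partial>?N) + ennreal \<epsilon> * (\<integral>\<^sup>+x. \<rho> x \<partial>?N)"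
      unfolding G_def using meas[OF h(1)] meas[OF \<rho>(1)] by (simp add: nn_integral_add nn_integral_cmult)
    also have "(\<integral>\<^sup>+x. h x \<partial>?N) = (\<integral>\<^sup>+x. g x \<partial>?N)" by (rule nn_integral_cong_AE[OF h(3)])
    also have "(\<integral>\<^sup>+x. \<rho> x \<partial>?N) \<le> (\<integral>\<^sup>+x. \<rho> x \<partial>M)"
      unfolding nn_integral_restrict_open[OF open_domain] by (intro nn_integral_mono) (auto simp: indicator_def)
    also have "(\<integral>\<^sup>+x. g x \<partial>?N) + ennreal \<epsilon> * (\<integral>\<^sup>+x. \<rho> x \<partial>M) \<le> (I + ennreal (e / 2)) + ennreal (e / 2)"
      using g(2) \<epsilon> R by (intro add_mono) (auto simp: ennreal_mult[symmetric] ennreal_leI)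
    also have "\<dots> = I + ennreal e" using e by (simp add: add.assoc flip: ennreal_plus)
    finally have int: "(\<integral>\<^sup>+x. G x \<partial>?N) \<le> I + ennreal e" by (simp add: add_left_mono mult_left_mono)
    have "controls P G"
      unfolding controls_def
    proof (intro conjI meas G ballI)
      fix x assume x: "x \<in> \<Omega>"
      have d: "0 < bdist x" using bdist_pos x by simp
      define r where "r = 3 * \<eta> * bdist x"
      have r: "0 < r" "lam * r = bdist x / 2" using d \<eta>' lam by (auto simp: r_def eta)
      have r': "r \<le> lam * r" using lam r by simp
      have sub: "ball x r \<subseteq> \<Omega>" "ball x (lam * r) \<subseteq> \<Omega>"
        using ball_subset[of r x] ball_subset[of "lam * r" x] r' r(2) d by auto
      have em: "emeasure M (ball x s) = ennreal (vol x s)" if "ball x s \<subseteq> \<Omega>" for s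
        using emeasure_ball[OF mem_closure[OF x], of s] that by (simp add: emeasure_restrict_domain Int_absorb2)
      have "\<exists>k. (\<integral>\<^sup>+z. ennreal \<bar>real_of_ereal (u z) - k\<bar> * indicator (ball x r) z \<partial>?N) \<le>
        ennreal (C * r) * (\<integral>\<^sup>+z. G z * indicator (ball x (lam * r)) z \<partial>?N)"
      proof (rule local_poincare[OF open_domain um fin(1) poincare lam r(1) _ G _ _ ug])
        show "ball x (2 * (lam * r)) \<subseteq> \<Omega>" using ball_subset[of "bdist x" x] unfolding r(2) by simp
        show "g z \<le> G z" if "z \<in> \<Omega>" for z using h(2)[OF that] by (simp add: G_def add_increasing2)
        show "curve_integral a b \<gamma> G = \<infinity>" if "(a, b, \<gamma>) \<in> \<Gamma>" for a b \<gamma>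
        proof -
          have "curve_integral a b \<gamma> (\<lambda>x. ennreal \<epsilon> * \<rho> x) \<le> curve_integral a b \<gamma> G"
            by (rule curve_integral_mono) (simp add: G_def)
          then show ?thesis using curve_integral_cmult_top[OF bspec[OF \<rho>' that, simplified prod.case] \<epsilon>(1)] by (simp add: top.extremum_unique)
        qed
        show "0 < emeasure M (ball x r)" using em[OF sub(1)] vol_pos[OF mem_closure[OF x] r(1)] by simp
        show "emeasure M (ball x (lam * r)) < \<infinity>" using em[OF sub(2)] by simp
      qed
      then show "\<exists>k. (\<integral>\<^sup>+z. ennreal \<bar>real_of_ereal (u z) - k\<bar> * indicator (ball x (3 * \<eta> * bdist x)) z \<partial>?N) \<le>
       ennreal (P * bdist x) * (\<integral>\<^sup>+z. G z * indicator (ball x (bdist x / 2)) z \<partial>?N)"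
        unfolding r(2) unfolding r_def P_def by (simp add: mult.assoc)
    qed
    then show ?thesis using int by blast
  qed
  have norm: "ennreal B * ((\<integral>\<^sup>+x. ennreal \<bar>real_of_ereal (u x)\<bar> \<partial>?N) + I) \<le> ennreal B * newton_norm M \<Omega> u" for B
    unfolding newton by (intro mult_left_mono add_right_mono real_le) auto
  show ?thesis
  proof (rule that[of smooth])
    show "smooth \<in> lip_loc \<Omega>" by (rule smooth_lip_loc)
  next
    fix x k assume "x \<in> frontier \<Omega>" "has_boundary_value M \<Omega> u x k"
    then show "has_boundary_value M \<Omega> (\<lambda>x. ereal (smooth x)) x k"
      by (intro smooth_boundary_value[where w=u])
         (auto simp: nn_integral_restrict_subset open_domain emeasure_restrict_domain)
  next
    note near = smooth_hajlasz[where M=M and Q="near \<eta> \<Omega>" and P=P and K=1 and j=0 and D=D, OF refl controls fin(2) _ D0]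
    show "(\<lambda>x. ereal (smooth x)) \<in> M11_loc_space M \<Omega> \<eta>"
      using smooth_near_shadow[OF _ P] by (intro near(1)) (auto simp: DP)
    have "M11_loc_norm M \<Omega> \<eta> (\<lambda>x. ereal (smooth x)) \<le>
        ennreal (2 * c ^ n * c + D * c ^ 0) * ((\<integral>\<^sup>+x. ennreal \<bar>real_of_ereal (u x)\<bar> \<partial>?N) + I)"
      using smooth_near_shadow[OF _ P] by (intro near(2)) (auto simp: DP)
    then show "M11_loc_norm M \<Omega> \<eta> (\<lambda>x. ereal (smooth x)) \<le> ennreal (2 * c ^ n * c + D) * newton_norm M \<Omega> u"
      using norm[of "2 * c ^ n * c + D"] by simp
  next
    fix a :: real and j :: nat
    assume a: "0 < a" and j: "2 / a + 1 \<le> 2 ^ j" and uniform: "uniform_with a \<Omega>"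
    have Da: "0 < D / a" using D0 a by simp
    have grad: "ennreal \<bar>smooth x - smooth y\<bar> \<le> ennreal (dist x y) *
        (ennreal (D / a) * shadow (2 / a + 1) G x + ennreal (D / a) * shadow (2 / a + 1) G y)"
      if "controls P G" "x \<in> \<Omega>" "y \<in> \<Omega>" for G x y
      unfolding DP by (rule smooth_uniform_shadow[OF that(1) P that(2,3) a uniform])
    note glob = smooth_hajlasz[where M=M and Q="\<lambda>_ _. True" and P=P, OF refl controls fin(2) j Da grad]
    show "(\<lambda>x. ereal (smooth x)) \<in> M11_space M \<Omega> \<and>
      M11_norm M \<Omega> (\<lambda>x. ereal (smooth x)) \<le> ennreal (2 * c ^ n * c + D / a * c ^ j) * newton_norm M \<Omega> u"
      using glob order_trans[OF glob(2) norm] by blast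
  qed
qed

end

theorem theorem1p7:
  fixes mu nu :: "'a::complete_space set \<Rightarrow> ennreal"
    and M :: "'a measure"
    and \<Omega> :: "'a set"
  assumes "borel_regular_outer_measure mu"
    and "M = induced_measure UNIV mu"
    and "\<exists>Cd\<ge>1. doubling_on M UNIV Cd"
    and "poincare_1_1 M"
    and "open \<Omega>" and "\<Omega> \<noteq> {}" and "- \<Omega> \<noteq> {}"
    and "\<exists>cd>0. doubling_on M \<Omega> cd"
    and "radon_measure_on (frontier \<Omega>) nu"
  shows
    "(\<exists>C::real. C > 0 \<and> (\<forall>u Tu. u \<in> newton_space M \<Omega> \<and> is_trace M nu \<Omega> u Tu \<longrightarrow>
        (\<exists>cH v. 0 < cH \<and> cH < 1 \<and>
           v \<in> lip_loc \<Omega> \<and> (\<lambda>x. ereal (v x)) \<in> M11_loc_space M \<Omega> cH \<and>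
           M11_loc_norm M \<Omega> cH (\<lambda>x. ereal (v x)) \<le> ennreal C * newton_norm M \<Omega> u \<and>
           is_trace M nu \<Omega> (\<lambda>x. ereal (v x)) Tu))) \<and>
     (uniform_domain \<Omega> \<longrightarrow>
      (\<exists>C::real. C > 0 \<and> (\<forall>u Tu. u \<in> newton_space M \<Omega> \<and> is_trace M nu \<Omega> u Tu \<longrightarrow>
        (\<exists>v. v \<in> lip_loc \<Omega> \<and> (\<lambda>x. ereal (v x)) \<in> M11_space M \<Omega> \<and>
           M11_norm M \<Omega> (\<lambda>x. ereal (v x)) \<le> ennreal C * newton_norm M \<Omega> u \<and>
           is_trace M nu \<Omega> (\<lambda>x. ereal (v x)) Tu))))" (is "?loc \<and> (_ \<longrightarrow> ?glob)")
proof -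
  interpret caratheodory_measure mu M using assms(1,2) by unfold_locales
  obtain c where c: "0 < c" "doubling_on M \<Omega> c" using assms(8) by blast
  obtain C lam where C: "0 < C" and lam: "1 \<le> lam" and poincare: "\<forall>x. \<forall>r>0. \<forall>u\<in>L1_loc M. \<forall>g. upper_gradient u g \<longrightarrow>
     mean_deviation M (ball x r) u (mean_value M (ball x r) u) \<le>
       ennreal (C * r) * ((\<integral>\<^sup>+y. g y \<partial>restrict_space M (ball x (lam * r))) / emeasure M (ball x (lam * r)))"
    using assms(4) unfolding poincare_1_1_def by blast
  have em: "emeasure (restrict_space M \<Omega>) (A \<inter> \<Omega>) = emeasure M (A \<inter> \<Omega>)" for A
    using \<open>open \<Omega>\<close> by (intro emeasure_restrict_space) (auto simp: space_M open_sets_M)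
  interpret poincare_domain mu M \<Omega> c C lam
  proof unfold_locales
    show "space (restrict_space M \<Omega>) = \<Omega>" by (simp add: space_restrict_space space_M)
    show "U \<inter> \<Omega> \<in> sets (restrict_space M \<Omega>)" if "open U" for U
      using that \<open>open \<Omega>\<close> by (subst sets_restrict_space_iff) (auto simp: space_M open_sets_M open_Int)
    fix x r assume x: "x \<in> closure \<Omega>" and r: "0 < (r::real)"
    have d: "0 < emeasure M (ball x (2 * s) \<inter> \<Omega>) \<and> emeasure M (ball x (2 * s) \<inter> \<Omega>) \<le> ennreal c * emeasure M (ball x s \<inter> \<Omega>) \<and>
        ennreal c * emeasure M (ball x s \<inter> \<Omega>) < \<infinity>" if "0 < s" for s
      using c(2) x that unfolding doubling_on_def by blast
    \<comment> \<open>The definition asserts positivity only for the doubled radius, hence the use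
      of \<open>r / 2\<close>.\<close>
    have "0 < emeasure M (ball x r \<inter> \<Omega>)" using d[of "r / 2"] r by simp
    moreover have "emeasure M (ball x r \<inter> \<Omega>) < \<infinity>"
      using d[OF r] c(1) by (auto simp: ennreal_mult_less_top)
    ultimately show "0 < emeasure (restrict_space M \<Omega>) (ball x r \<inter> \<Omega>) \<and>
       emeasure (restrict_space M \<Omega>) (ball x r \<inter> \<Omega>) < \<infinity> \<and>
       emeasure (restrict_space M \<Omega>) (ball x (2 * r) \<inter> \<Omega>) \<le> ennreal c * emeasure (restrict_space M \<Omega>) (ball x r \<inter> \<Omega>)"
      unfolding em using d[OF r] by blast
  qed (use assms c C lam poincare in auto)
  define \<eta> where "\<eta> = 1 / (6 * lam)"
  have \<eta>: "0 < \<eta>" "\<eta> < 1" using lam by (auto simp: \<eta>_def field_simps)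
  obtain n where "2 / \<eta> < 2 ^ n" using real_arch_pow[of 2] by auto
  then have n: "2 \<le> 2 ^ n * \<eta>" using \<eta> by (simp add: field_simps)
  define D where "D = 4 * c ^ n * (1 + 2 * c ^ n * c) / \<eta> * (C * (3 * \<eta>)) * c"
  have D: "0 < D" using c(1) C \<eta> by (auto simp: D_def intro!: mult_pos_pos divide_pos_pos add_pos_pos)
  \<comment> \<open>The transfer is pointwise on the boundary, so the exceptional set for
    \<open>u\<close> also serves for \<open>v\<close>.\<close>
  have trace: "is_trace M nu \<Omega> v Tu"
    if "is_trace M nu \<Omega> u Tu" "\<And>x k. x \<in> frontier \<Omega> \<Longrightarrow> has_boundary_value M \<Omega> u x k \<Longrightarrow> has_boundary_value M \<Omega> v x k"
    for u v Tu
  proof -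
    have "space (induced_measure (frontier \<Omega>) nu) = frontier \<Omega>"
      using assms(9) by (intro space_induced_measure) (simp add: radon_measure_on_def)
    then have "AE x in induced_measure (frontier \<Omega>) nu.
        has_boundary_value M \<Omega> u x (Tu x) \<longrightarrow> has_boundary_value M \<Omega> v x (Tu x)"
      by (intro AE_I2 impI that(2)) simp
    from AE_mp[OF that(1)[unfolded is_trace_def] this] show ?thesis unfolding is_trace_def .
  qed
  note approx = smooth_approximation[OF _ \<eta>_def n D_def]
  show ?thesis
  proof (intro conjI impI)
    show ?loc
    proof (rule exI[of _ "2 * c ^ n * c + D"], intro conjI allI impI)
      show "0 < 2 * c ^ n * c + D" using c(1) D by (intro add_pos_pos) auto
      fix u Tu assume u: "u \<in> newton_space M \<Omega> \<and> is_trace M nu \<Omega> u Tu"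
      obtain v where "v \<in> lip_loc \<Omega>"
        and bv: "\<And>x k. x \<in> frontier \<Omega> \<Longrightarrow> has_boundary_value M \<Omega> u x k \<Longrightarrow> has_boundary_value M \<Omega> (\<lambda>x. ereal (v x)) x k"
        and "(\<lambda>x. ereal (v x)) \<in> M11_loc_space M \<Omega> \<eta>"
        "M11_loc_norm M \<Omega> \<eta> (\<lambda>x. ereal (v x)) \<le> ennreal (2 * c ^ n * c + D) * newton_norm M \<Omega> u"
        using approx[OF conjunct1[OF u]] by metis
      moreover have "is_trace M nu \<Omega> (\<lambda>x. ereal (v x)) Tu" by (rule trace[OF conjunct2[OF u] bv])
      ultimately show "\<exists>cH v. 0 < cH \<and> cH < 1 \<and>
           v \<in> lip_loc \<Omega> \<and> (\<lambda>x. ereal (v x)) \<in> M11_loc_space M \<Omega> cH \<and>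
           M11_loc_norm M \<Omega> cH (\<lambda>x. ereal (v x)) \<le> ennreal (2 * c ^ n * c + D) * newton_norm M \<Omega> u \<and>
           is_trace M nu \<Omega> (\<lambda>x. ereal (v x)) Tu"
        using \<eta> by blast
    qed
  next
    assume "uniform_domain \<Omega>"
    then obtain a where a: "0 < a" and uniform: "uniform_with a \<Omega>"
      unfolding uniform_domain_def uniform_with_def[symmetric] by (elim conjE exE) (rule that)
    \<comment> \<open>The number of doublings that cover the aperture belonging to
      \<open>k = 1 / a\<close>.\<close>
    obtain j where j: "2 / a + 1 < 2 ^ j" using real_arch_pow[of 2] by auto
    show ?glob
    proof (rule exI[of _ "2 * c ^ n * c + D / a * c ^ j"], intro conjI allI impI)
      show "0 < 2 * c ^ n * c + D / a * c ^ j" using c(1) D a by (intro add_pos_pos mult_pos_pos divide_pos_pos) auto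
      fix u Tu assume u: "u \<in> newton_space M \<Omega> \<and> is_trace M nu \<Omega> u Tu"
      show "\<exists>v. v \<in> lip_loc \<Omega> \<and> (\<lambda>x. ereal (v x)) \<in> M11_space M \<Omega> \<and>
           M11_norm M \<Omega> (\<lambda>x. ereal (v x)) \<le> ennreal (2 * c ^ n * c + D / a * c ^ j) * newton_norm M \<Omega> u \<and>
           is_trace M nu \<Omega> (\<lambda>x. ereal (v x)) Tu"
      proof (rule approx[OF conjunct1[OF u]], goal_cases)
        case (1 v)
        have "is_trace M nu \<Omega> (\<lambda>x. ereal (v x)) Tu" by (rule trace[OF conjunct2[OF u] 1(2)])
        then show ?case using 1(1) 1(5)[OF a less_imp_le[OF j] uniform] by blast
      qed
    qed
  qed
qed

end
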